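(* The affine subspace $M$ is invariant under the flow of the vorticity $w(t,\cdot)$ on $B_{r_0}$ defined by the Oseen system $$\frac{\partial w_k(t,r)}{\partial t}-\Delta_k w_k(t,r)+[(\mathbf{v}_\infty,\nabla w)]_k=0,\qquad w_k(0,r)=w_k^0(r),\qquad k\in\mathbb{Z},\ r>r_0,$$ with boundary conditions $$r_0\frac{\partial w_k(t,r)}{\partial r}\Big|_{r=r_0}+|k|\,w_k(t,r_0)=r_0\big(v_{\infty,r,1}\,w_{k-1}(t,r_0)+v_{\infty,r,-1}\,w_{k+1}(t,r_0)\big),\qquad k\in\mathbb{Z},$$ and $w(t,\mathbf{x})\to 0$ as $|\mathbf{x}|\to\infty$. That is, if the initial vorticity $w(0,\cdot)$ belongs to $M$, then $w(t,\cdot)\in M$ for all $t>0$.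
   Context: Let $r_0>0$ and $B_{r_0}=\{\mathbf{x}\in\mathbb{R}^2: |\mathbf{x}|>r_0\}$. Points $\mathbf{x}=(x_1,x_2)$ are identified with $z=x_1+ix_2=re^{i\varphi}$. For a function $f$ on $B_{r_0}$, $f_k(r)=[f]_k(r)=\frac1{2\pi}\int_0^{2\pi}f(r,\varphi)e^{-ik\varphi}\,d\varphi$ denotes its $k$-th angular Fourier coefficient; $w$ is real-valued, with Fourier coefficients $w_k(t,r)$, and $$\Delta_k w_k(t,r)=\frac1r\frac{\partial}{\partial r}\Big(r\frac{\partial}{\partial r}w_k(t,r)\Big)-\frac{k^2}{r^2}w_k(t,r).$$ The vector $\mathbf{v}_\infty=(v_{\infty,x},v_{\infty,y})\in\mathbb{R}^2$ is a given constant, $(\mathbf{v}_\infty,\nabla w)=v_{\infty,x}\partial_{x_1}w+v_{\infty,y}\partial_{x_2}w$, and the Fourier coefficients of the radial component of $\mathbf{v}_\infty$ are $$v_{\infty,r,k}=\frac{\delta_{|k|,1}}{2}(v_{\infty,x}-ik\,v_{\infty,y}),\qquad k\in\mathbb{Z}.$$ The affine subspace $M$ is $$M=\Big\{w\in L_1(B_{r_0})\ \Big|\ \int_{B_{r_0}}\frac{w(\mathbf{x})}{z^k}\,d\mathbf{x}=4\pi i k\,v_{\infty,r,k},\ k\ge 0,\ k\in\mathbb{Z}\Big\}.$$ *)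

theory Defs
  imports "HOL-Analysis.Analysis"
begin

text \<open>
  The plane is identified with the complex numbers. A function on the exterior domain is
  a total function whose values inside the disc are irrelevant; the values on the circle
  $|z| = r_0$ matter only in the boundary condition, where they are the boundary trace.
\<close>

definition exterior :: "real \<Rightarrow> complex set" where
  "exterior r0 = {z. r0 < norm z}"

definition ang_coeff :: "(complex \<Rightarrow> real) \<Rightarrow> int \<Rightarrow> real \<Rightarrow> complex" where
  "ang_coeff f k r =
     1 / (2 * pi) * (LINT \<phi>:{0..2*pi}|lebesgue. of_real (f (rcis r \<phi>)) * cis (- (of_int k * \<phi>)))"

definition Delta_k :: "int \<Rightarrow> (real \<Rightarrow> complex) \<Rightarrow> real \<Rightarrow> complex" where
  "Delta_k k g r =
     1 / r * vector_derivative (\<lambda>\<rho>. of_real \<rho> * vector_derivative g (at \<rho>)) (at r)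
     - of_int (k\<^sup>2) / (of_real r)\<^sup>2 * g r"

definition partial_x1 :: "(complex \<Rightarrow> real) \<Rightarrow> complex \<Rightarrow> real" where
  "partial_x1 f z = deriv (\<lambda>s::real. f (z + of_real s)) 0"

definition partial_x2 :: "(complex \<Rightarrow> real) \<Rightarrow> complex \<Rightarrow> real" where
  "partial_x2 f z = deriv (\<lambda>s::real. f (z + \<i> * of_real s)) 0"

definition drift :: "real \<Rightarrow> real \<Rightarrow> (complex \<Rightarrow> real) \<Rightarrow> complex \<Rightarrow> real" where
  "drift vx vy f z = vx * partial_x1 f z + vy * partial_x2 f z"

definition v_rad :: "real \<Rightarrow> real \<Rightarrow> int \<Rightarrow> complex" where
  "v_rad vx vy k = (if \<bar>k\<bar> = 1 then 1 else 0) / 2 * (of_real vx - \<i> * of_int k * of_real vy)"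

definition M :: "real \<Rightarrow> real \<Rightarrow> real \<Rightarrow> (complex \<Rightarrow> real) set" where
  "M r0 vx vy =
     {w. set_integrable lebesgue (exterior r0) w \<and>
         (\<forall>k::nat. (LINT z:exterior r0|lebesgue. of_real (w z) / z ^ k)
                    = 4 * pi * \<i> * of_nat k * v_rad vx vy (int k))}"

text \<open>
  The initial-boundary value problem itself. The radial derivative at $r_0$ is the one-sided
  derivative from the exterior.
\<close>

definition oseen_system ::
  "real \<Rightarrow> real \<Rightarrow> real \<Rightarrow> (int \<Rightarrow> real \<Rightarrow> complex) \<Rightarrow> (real \<Rightarrow> complex \<Rightarrow> real) \<Rightarrow> bool" where
  "oseen_system r0 vx vy w0 w \<longleftrightarrow>
     (\<forall>k. \<forall>t>0. \<forall>r>r0.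
        vector_derivative (\<lambda>s. ang_coeff (w s) k r) (at t)
        - Delta_k k (ang_coeff (w t) k) r + ang_coeff (drift vx vy (w t)) k r = 0) \<and>
     (\<forall>k. \<forall>r>r0. ang_coeff (w 0) k r = w0 k r) \<and>
     (\<forall>k. \<forall>t>0.
        of_real r0 * vector_derivative (ang_coeff (w t) k) (at r0 within {r0..})
        + of_int \<bar>k\<bar> * ang_coeff (w t) k r0
        = of_real r0 * (v_rad vx vy 1 * ang_coeff (w t) (k - 1) r0
                        + v_rad vx vy (- 1) * ang_coeff (w t) (k + 1) r0)) \<and>
     (\<forall>t>0. (w t \<longlongrightarrow> 0) at_infinity)"

text \<open>
  The derivatives above are total operators, so the regularity that makes the equations
  meaningful is stated separately. It is that of a classical solution for $t > 0$: \<open>w\<close> is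
  continuous up to the boundary circle and continuously differentiable in space inside, and each
  coefficient is $C^1$ in $t$ and $C^2$ in $r$ for $r > r_0$, with $\partial_r w_k$ continuous
  up to $r = r_0$. Nothing of the kind is required at $t = 0$.
\<close>

definition classical_regularity :: "real \<Rightarrow> (real \<Rightarrow> complex \<Rightarrow> real) \<Rightarrow> bool" where
  "classical_regularity r0 w \<longleftrightarrow>
     continuous_on ({0<..} \<times> {z. r0 \<le> norm z}) (\<lambda>(t, z). w t z) \<and>
     (\<forall>t>0. \<forall>z\<in>exterior r0. w t differentiable (at z)) \<and>
     continuous_on ({0<..} \<times> exterior r0) (\<lambda>(t, z). partial_x1 (w t) z) \<and>
     continuous_on ({0<..} \<times> exterior r0) (\<lambda>(t, z). partial_x2 (w t) z) \<and>
     (\<forall>k.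
        (\<forall>t>0. \<forall>r>r0. (\<lambda>s. ang_coeff (w s) k r) differentiable (at t)) \<and>
        continuous_on ({0<..} \<times> {r0<..})
          (\<lambda>(t, r). vector_derivative (\<lambda>s. ang_coeff (w s) k r) (at t)) \<and>
        (\<forall>t>0. \<forall>r\<ge>r0. ang_coeff (w t) k differentiable (at r within {r0..})) \<and>
        continuous_on ({0<..} \<times> {r0..})
          (\<lambda>(t, r). vector_derivative (ang_coeff (w t) k) (at r within {r0..})) \<and>
        (\<forall>t>0. \<forall>r>r0.
           (\<lambda>\<rho>. vector_derivative (ang_coeff (w t) k) (at \<rho>)) differentiable (at r)) \<and>
        continuous_on ({0<..} \<times> {r0<..})
          (\<lambda>(t, r). vector_derivative (\<lambda>\<rho>. vector_derivative (ang_coeff (w t) k) (at \<rho>)) (at r)))"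

text \<open>
  The phase space is $L_1$ of the exterior domain; a trajectory is a continuous curve in it on
  $[0, \infty)$. Continuity at $t = 0$ is what attaches the solution to its initial value.
\<close>

definition L1_trajectory :: "real \<Rightarrow> (real \<Rightarrow> complex \<Rightarrow> real) \<Rightarrow> bool" where
  "L1_trajectory r0 w \<longleftrightarrow>
     (\<forall>t\<ge>0. set_integrable lebesgue (exterior r0) (w t)) \<and>
     (\<forall>t\<ge>0. ((\<lambda>s. LINT z:exterior r0|lebesgue. \<bar>w s z - w t z\<bar>) \<longlongrightarrow> 0) (at t within {0..}))"

definition oseen_flow ::
  "real \<Rightarrow> real \<Rightarrow> real \<Rightarrow> (int \<Rightarrow> real \<Rightarrow> complex) \<Rightarrow> (real \<Rightarrow> complex \<Rightarrow> real) \<Rightarrow> bool" where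
  "oseen_flow r0 vx vy w0 w \<longleftrightarrow>
     L1_trajectory r0 w \<and> classical_regularity r0 w \<and> oseen_system r0 vx vy w0 w"

end

theory Submission
  imports Defs
begin

text \<open>
  Write $\mu_k(t) = \int_{|z| > r_0} w(t,z) z^{-k}\, dz$ and $V = v_x + i v_y$. Since $z^{-k}$ is
  harmonic, testing the Oseen equation with it leaves only boundary terms from the Laplacian. The
  boundary condition says that these cancel the inflow through the circle $|z| = r_0$ produced by
  the drift. What remains is the derivative of $z^{-k}$ along the drift, so that
  \[ \mu_k' = - k V \mu_{k+1}, \qquad k \ge 0 . \]
  On $M$ the moments of order $k \ge 2$ vanish. Although the hierarchy is open upwards, it
  propagates this: $|\mu_k(t)| \le \|w(t)\|_1 r_0^{-k}$, and $n$ integrations of the hierarchy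
  multiply this bound by ${k+n-1 \choose n} (|V| t / r_0)^n$, which tends to $0$ with $n$ for short
  times; finitely many short steps reach any time (\<open>hierarchy_unique\<close>). Hence $\mu_1$ and $\mu_0$
  are constant as well, and all moments keep the values prescribed by $M$.

  The hierarchy has to be derived from equations for the Fourier coefficients $w_k$, and
  $\mu_k = 2\pi \int_{r_0}^\infty r^{1-k} w_k\, dr$ in polar coordinates
  (\<open>has_integral_polar_annulus\<close>). The drift couples $w_k$ to its two neighbours
  (\<open>ang_coeff_drift\<close>), and the equation takes the form of a conservation law
  \[ r^{1-k} \partial_t w_k + k V r^{-k} w_{k+1} = \partial_r F_k \]
  whose flux $F_k$ vanishes at $r = r_0$ exactly by the boundary condition
  (\<open>flux_has_vector_derivative\<close>, \<open>flux_boundary\<close>). Neither $\partial_t w_k$ near the circle nor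
  the derivatives of $w_k$ at infinity are controlled by the hypotheses. The law is therefore integrated against a
  cutoff on $[a, a + L]$ with $a > r_0$, and all radial derivatives are moved onto the cutoff. The
  resulting error is at most a constant times $\|w(t)\|_1 / L$; the limit $a \to r_0$,
  $L \to \infty$ under the time integral gives the hierarchy (\<open>moment_increment\<close>). Continuity of
  $t \mapsto w(t)$ in $L_1$ extends it to $t = 0$.
\<close>

section \<open>Integration over an annulus in polar coordinates\<close>

definition annulus :: "real \<Rightarrow> real \<Rightarrow> complex set" where
  "annulus a b = {z. a \<le> norm z \<and> norm z \<le> b}"

text \<open>
  The change of variables theorem for multiple integrals is about coordinate vectors, so the plane
  is also presented as \<open>real^2\<close>.
\<close>

definition cart :: "complex \<Rightarrow> real^2" where
  "cart z = vector [Re z, Im z]"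

definition cplx :: "real^2 \<Rightarrow> complex" where
  "cplx x = Complex (x$1) (x$2)"

lemma cart_cplx [simp]: "cart (cplx x) = x" "cplx (cart z) = z"
  by (auto simp: cart_def cplx_def vec_eq_iff forall_2 complex_eq_iff)

lemma linear_cart: "linear cart"
  by (auto intro!: linearI simp: cart_def vec_eq_iff forall_2)

lemma linear_cplx: "linear cplx"
  by (auto intro!: linearI simp: cplx_def complex_eq_iff)

lemma cart_image_cbox: "cart ` cbox u v = cbox (cart u) (cart v)"
proof -
  have "x \<in> cart ` cbox u v \<longleftrightarrow> cplx x \<in> cbox u v" for x
    by (metis cart_cplx imageE imageI)
  then show ?thesis
    by (auto simp: set_eq_iff in_cbox_complex_iff mem_box_cart forall_2 cplx_def cart_def)
qed

lemma cplx_image_cbox: "cplx ` cbox u v = cbox (cplx u) (cplx v)"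
proof -
  have "cplx ` cbox u v = cplx ` cart ` cbox (cplx u) (cplx v)"
    by (simp only: cart_image_cbox cart_cplx)
  then show ?thesis
    by (simp add: image_image)
qed

lemma measure_cart_image: "measure lborel (cart ` cbox u v) = measure lborel (cbox u v)"
proof -
  have "cbox (cart u) (cart v) = {} \<longleftrightarrow> cbox u v = {}"
    by (metis cart_image_cbox image_is_empty)
  then show ?thesis
    unfolding cart_image_cbox content_cbox_if_cart content_cbox_if
    by (simp add: Basis_complex_def UNIV_2 cart_def)
qed

lemma has_integral_cart:
  fixes F :: "real^2 \<Rightarrow> 'a::banach"
  assumes "(F has_integral I) A" "bounded A"
  shows "((\<lambda>z. F (cart z)) has_integral I) (cplx ` A)"
proof -
  obtain c d where A: "A \<subseteq> cbox c d"
    using bounded_subset_cbox_symmetric[OF assms(2)] by metis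
  have FA: "((\<lambda>x. if x \<in> A then F x else 0) has_integral I) (cbox c d)"
    using A assms(1) by simp
  have "((\<lambda>z. if cart z \<in> A then F (cart z) else 0) has_integral (1/1) *\<^sub>R I) (cplx ` cbox c d)"
  proof (rule has_integral_twiddle[OF _ _ _ _ _ _ _ FA])
    show "continuous (at x) cart" for x
      by (intro linear_continuous_at) (simp add: linear_cart flip: linear_conv_bounded_linear)
    show "\<exists>w z. cart ` cbox u v = cbox w z" "\<exists>w z. cplx ` cbox x y = cbox w z" for u v x y
      unfolding cart_image_cbox cplx_image_cbox by blast+
    show "measure lborel (cart ` cbox u v) = 1 * measure lborel (cbox u v)" for u v
      by (simp add: measure_cart_image)
  qed simp_all
  moreover have "cart z \<in> A \<longleftrightarrow> z \<in> cplx ` A" for z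
    by (metis cart_cplx imageE imageI)
  ultimately show ?thesis
    using A by (simp add: image_mono)
qed

text \<open>
  Fubini's theorem on a rectangle of coordinate vectors, transported from the product type along the
  measure preserving bijection between the two.
\<close>

lemma integral_cart2_iterated:
  fixes f :: "real \<Rightarrow> real \<Rightarrow> 'a::euclidean_space"
  assumes "continuous_on ({a..b} \<times> {c..d}) (\<lambda>(x, y). f x y)"
  shows "((\<lambda>x::real^2. f (x$1) (x$2)) has_integral integral {a..b} (\<lambda>x. integral {c..d} (f x)))
           (cbox (vector [a, c]) (vector [b, d]))"
proof -
  let ?g = "\<lambda>x::real^2. (x$1, x$2)" and ?h = "\<lambda>p::real\<times>real. vector [fst p, snd p] :: real^2"
  have cont: "continuous_on (cbox (a, c) (b, d)) (\<lambda>(x, y). f x y)"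
    using assms by (simp add: cbox_Pair_eq)
  have "((\<lambda>(x, y). f x y) has_integral integral (cbox (a,c) (b,d)) (\<lambda>(x, y). f x y)) (cbox (a, c) (b, d))"
    using cont by (intro integrable_integral integrable_continuous)
  then have 1: "((\<lambda>(x, y). f x y) has_integral integral {a..b} (\<lambda>x. integral {c..d} (f x))) (cbox (a, c) (b, d))"
    using integral_prod_continuous[OF cont] by (simp add: split_def)
  have hg: "?h (?g x) = x" "?g (?h p) = p" for x p
    by (auto simp: vec_eq_iff forall_2)
  have gimg: "?g ` cbox u v = cbox (u$1, u$2) (v$1, v$2)" for u v
  proof -
    have "p \<in> ?g ` cbox u v \<longleftrightarrow> ?h p \<in> cbox u v" for p
      using hg by (intro iffI) (force, metis (no_types, lifting) image_iff)
    then show ?thesis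
      by (auto simp: set_eq_iff mem_box_cart forall_2 cbox_Pair_eq)
  qed
  have himg: "?h ` cbox p q = cbox (?h p) (?h q)" for p q
  proof -
    have "x \<in> ?h ` cbox p q \<longleftrightarrow> ?g x \<in> cbox p q" for x
      by (metis (no_types, lifting) hg imageE imageI)
    then show ?thesis
      by (cases p; cases q) (auto simp: set_eq_iff mem_box_cart forall_2 cbox_Pair_eq)
  qed
  have cont2: "measure lborel (?g ` cbox u v) = 1 * measure lborel (cbox u v)" for u v
  proof (cases "cbox u v = {}")
    case False
    then have "u$1 \<le> v$1" "u$2 \<le> v$2"
      by (simp_all add: interval_ne_empty_cart)
    then show ?thesis
      unfolding gimg content_Pair content_cbox_cart[OF False] by (simp add: UNIV_2)
  qed simp
  have "((\<lambda>x. (\<lambda>(x, y). f x y) (?g x)) has_integral (1/1) *\<^sub>R integral {a..b} (\<lambda>x. integral {c..d} (f x)))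
     (?h ` cbox (a, c) (b, d))"
  proof (rule has_integral_twiddle[OF _ hg(1) hg(2) _ _ _ cont2 1])
    show "continuous (at x) ?g" for x
      by (intro continuous_intros)
    show "\<exists>w z. ?g ` cbox u v = cbox w z" "\<exists>w z. ?h ` cbox p q = cbox w z" for u v p q
      unfolding gimg himg by blast+
  qed simp
  then show ?thesis
    by (simp add: himg)
qed

text \<open>
  The angle runs over the half-open interval, so that polar coordinates are injective and cover the
  whole annulus.
\<close>

lemma polar_image:
  fixes a b :: real and S :: "(real^2) set"
  assumes "0 < a" and S_def: "S = {x::real^2. a \<le> x$1 \<and> x$1 \<le> b \<and> 0 \<le> x$2 \<and> x$2 < 2*pi}"
  shows "inj_on (\<lambda>x. cart (rcis (x$1) (x$2))) S"
    and "(\<lambda>x. cart (rcis (x$1) (x$2))) ` S = cart ` annulus a b"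
proof -
  have *: "norm (rcis (x$1) (x$2)) = x$1" "Arg2pi (rcis (x$1) (x$2)) = x$2" if "x \<in> S" for x
  proof -
    show "norm (rcis (x$1) (x$2)) = x$1"
      using that assms by simp
    show "Arg2pi (rcis (x$1) (x$2)) = x$2"
      by (rule Arg2pi_unique[of "x$1"]) (use that assms in \<open>auto simp: rcis_def cis_conv_exp\<close>)
  qed
  show "inj_on (\<lambda>x. cart (rcis (x$1) (x$2))) S"
  proof (intro inj_onI)
    fix x y
    assume xy: "x \<in> S" "y \<in> S" "cart (rcis (x$1) (x$2)) = cart (rcis (y$1) (y$2))"
    then have "rcis (x$1) (x$2) = rcis (y$1) (y$2)"
      by (metis cart_cplx(2))
    then show "x = y"
      using *[OF xy(1)] *[OF xy(2)] by (auto simp: vec_eq_iff forall_2)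
  qed
  have "rcis (norm z) (Arg2pi z) = z" for z
    by (metis Arg2pi_eq rcis_def cis_conv_exp)
  then have "z \<in> (\<lambda>x. rcis (x$1) (x$2)) ` S" if "a \<le> norm z" "norm z \<le> b" for z
    using that Arg2pi[of z]
    by (intro image_eqI[of _ _ "vector [norm z, Arg2pi z]"]) (simp_all add: S_def)
  moreover have "a \<le> norm (rcis (x$1) (x$2)) \<and> norm (rcis (x$1) (x$2)) \<le> b" if "x \<in> S" for x
    using * [OF that] that by (auto simp: S_def)
  ultimately have "(\<lambda>x. rcis (x$1) (x$2)) ` S = annulus a b"
    by (auto simp: annulus_def)
  then show "(\<lambda>x. cart (rcis (x$1) (x$2))) ` S = cart ` annulus a b"
    by (metis image_image)
qed

lemma has_integral_polar_annulus:
  fixes f :: "complex \<Rightarrow> complex"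
  assumes a: "0 < a" and f: "continuous_on (annulus a b) f"
  shows "(f has_integral integral {a..b} (\<lambda>r. of_real r * integral {0..2*pi} (\<lambda>\<phi>. f (rcis r \<phi>))))
            (annulus a b)"
proof -
  define A where "A = annulus a b"
  define S where "S = {x::real^2. a \<le> x$1 \<and> x$1 \<le> b \<and> 0 \<le> x$2 \<and> x$2 < 2*pi}"
  define B where "B = cbox (vector [a, 0]) (vector [b, 2*pi] :: real^2)"
  define g where "g = (\<lambda>x::real^2. cart (rcis (x$1) (x$2)))"
  define g' where "g' = (\<lambda>x::real^2. \<lambda>h::real^2. vector [h$1 * cos (x$2) - x$1 * sin (x$2) * h$2,
      h$1 * sin (x$2) + x$1 * cos (x$2) * h$2] :: real^2)"
  define F where "F = cart \<circ> f \<circ> cplx"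
  let ?J = "integral {a..b} (\<lambda>r. integral {0..2*pi} (\<lambda>\<phi>. of_real r * f (rcis r \<phi>)))"
  have B: "B = {x. a \<le> x$1 \<and> x$1 \<le> b \<and> 0 \<le> x$2 \<and> x$2 \<le> 2*pi}"
    by (auto simp: B_def mem_box_cart forall_2)
  have SB: "S = B - {x. x$2 = 2*pi}"
    by (auto simp: S_def B)
  have neg: "negligible {x::real^2. x$2 = 2*pi}"
    using negligible_standard_hyperplane[of "axis 2 1 :: real^2" "2*pi"]
    by (auto simp: cart_eq_inner_axis Basis_vec_def)
  have S: "S \<in> sets lebesgue"
    unfolding SB B_def using neg by (simp add: negligible_imp_sets sets.Diff)
  have dg: "(g has_derivative g' x) (at x within S)" for x
  proof -
    have "((\<lambda>x. Re (cplx (g x))) has_derivative (\<lambda>h. Re (cplx (g' x h)))) (at x within S)"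
      "((\<lambda>x. Im (cplx (g x))) has_derivative (\<lambda>h. Im (cplx (g' x h)))) (at x within S)"
      unfolding g_def g'_def cart_cplx unfolding cplx_def
      by (auto intro!: derivative_eq_intros bounded_linear_imp_has_derivative bounded_linear_vec_nth
          simp: algebra_simps)
    then have *: "((\<lambda>x. g x $ i) has_derivative (\<lambda>h. g' x h $ i)) (at x within S)" for i
      using exhaust_2[of i] by (auto simp: cplx_def)
    show ?thesis
      by (subst has_derivative_componentwise_within)
        (use * in \<open>auto simp: Basis_vec_def inner_axis\<close>)
  qed
  have inj: "inj_on g S" and gS: "g ` S = cart ` A"
    using polar_image[OF a S_def] unfolding g_def A_def by auto
  \<comment> \<open>the Jacobian of polar coordinates is the radius\<close>
  have det: "\<bar>det (matrix (g' x))\<bar> = x$1" if "x \<in> B" for x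
  proof -
    have "det (matrix (g' x)) = cos (x$2) * (x$1 * cos (x$2)) + x$1 * sin (x$2) * sin (x$2)"
      by (simp add: det_2 matrix_def g'_def axis_def)
    also have "\<dots> = x$1 * (cos (x$2) * cos (x$2) + sin (x$2) * sin (x$2))"
      by (simp only: distrib_left mult_ac)
    also have "\<dots> = x$1"
      by (simp only: sin_cos_squared_add3 mult_1_right)
    finally have "det (matrix (g' x)) = x$1" .
    then show ?thesis
      using that a by (simp add: B)
  qed
  have cov: "(\<lambda>x. \<bar>det (matrix (g' x))\<bar> *\<^sub>R F (g x)) absolutely_integrable_on S \<and>
      integral S (\<lambda>x. \<bar>det (matrix (g' x))\<bar> *\<^sub>R F (g x)) = b \<longleftrightarrow>
      F absolutely_integrable_on cart ` A \<and> integral (cart ` A) F = b" for b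
    by (rule has_absolute_integral_change_of_variables[OF S dg inj, unfolded gS])
  have ring: "rcis r \<phi> \<in> A" if "r \<in> {a..b}" for r \<phi>
    using that a by (auto simp: A_def annulus_def)
  have fA: "continuous_on A f"
    using f by (simp add: A_def)
  have cont: "continuous_on ({a..b} \<times> {0..2*pi}) (\<lambda>(r, \<phi>). of_real r * f (rcis r \<phi>))"
    unfolding split_def
    by (intro continuous_intros continuous_on_compose2[OF fA])
      (use ring in \<open>auto simp: rcis_def intro!: continuous_intros\<close>)
  have K: "((\<lambda>x::real^2. of_real (x$1) * f (rcis (x$1) (x$2))) has_integral ?J) B"
    unfolding B_def by (rule integral_cart2_iterated[OF cont])
  have det_F: "\<bar>det (matrix (g' x))\<bar> *\<^sub>R F (g x) = cart (of_real (x$1) * f (rcis (x$1) (x$2)))"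
    if "x \<in> B" for x
    unfolding det[OF that] using linear_cart
    by (simp add: F_def g_def scaleR_conv_of_real[symmetric] linear_cmul)
  have KB: "((\<lambda>x. \<bar>det (matrix (g' x))\<bar> *\<^sub>R F (g x)) has_integral cart ?J) B"
  proof -
    have "((\<lambda>x. cart (of_real (x$1) * f (rcis (x$1) (x$2)))) has_integral cart ?J) B"
      using has_integral_linear[OF K linear_cart[unfolded linear_conv_bounded_linear]] by (simp only: o_def)
    then show ?thesis
      by (rule has_integral_eq[rotated]) (simp only: det_F)
  qed
  have "(\<lambda>x. \<bar>det (matrix (g' x))\<bar> *\<^sub>R F (g x)) absolutely_integrable_on B"
  proof -
    have "continuous_on B (\<lambda>x. of_real (x$1) * f (rcis (x$1) (x$2)))"
      by (intro continuous_intros continuous_on_compose2[OF fA])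
        (use ring in \<open>auto simp: rcis_def B intro!: continuous_intros\<close>)
    then have "continuous_on B (\<lambda>x. cart (of_real (x$1) * f (rcis (x$1) (x$2))))"
      by (rule linear_continuous_on_compose[OF _ linear_cart])
    then have "(\<lambda>x. cart (of_real (x$1) * f (rcis (x$1) (x$2)))) absolutely_integrable_on B"
      unfolding B_def by (rule absolutely_integrable_continuous)
    then show ?thesis
      by (rule absolutely_integrable_spike[OF _ negligible_empty]) (simp only: det_F Diff_empty)
  qed
  then have "(\<lambda>x. \<bar>det (matrix (g' x))\<bar> *\<^sub>R F (g x)) absolutely_integrable_on S"
    by (rule absolutely_integrable_spike_set)
      (rule negligible_subset[OF neg]; force simp: SB)+
  moreover have "integral S (\<lambda>x. \<bar>det (matrix (g' x))\<bar> *\<^sub>R F (g x)) = cart ?J"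
    unfolding integral_unique[OF KB, symmetric]
    by (rule integral_spike_set) (rule negligible_subset[OF neg]; force simp: SB)+
  ultimately have "F absolutely_integrable_on cart ` A" "integral (cart ` A) F = cart ?J"
    using cov by auto
  then have "(F has_integral cart ?J) (cart ` A)"
    using absolutely_integrable_on_def by (metis integrable_integral)
  moreover have "bounded (cart ` A)"
    by (rule bounded_linear_image) (auto simp: A_def annulus_def linear_cart bounded_iff simp flip: linear_conv_bounded_linear)
  ultimately have "((\<lambda>z. F (cart z)) has_integral cart ?J) (cplx ` cart ` A)"
    by (rule has_integral_cart)
  then have "((\<lambda>z. cart (f z)) has_integral cart ?J) A"
    by (simp add: F_def image_image)
  from has_integral_linear[OF this linear_cplx[unfolded linear_conv_bounded_linear]]
  show ?thesis
    by (simp add: o_def A_def)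
qed

section \<open>Fourier coefficients of the drift term\<close>

lemma integral_lincomb:
  fixes f g :: "real \<Rightarrow> complex"
  assumes "f integrable_on S" "g integrable_on S"
  shows "integral S (\<lambda>x. a * f x + c * g x) = a * integral S f + c * integral S g"
  using assms by (simp add: integral_add integrable_on_mult_right)

lemma continuous_on_ring:
  fixes f :: "complex \<Rightarrow> 'a::topological_space"
  assumes "continuous_on S f" "\<And>r \<phi>. r \<in> R \<Longrightarrow> rcis r \<phi> \<in> S"
  shows "continuous_on (R \<times> T) (\<lambda>(r, \<phi>). f (rcis r \<phi>))"
  unfolding split_def
  by (rule continuous_on_compose2[OF assms(1)])
    (use assms(2) in \<open>auto simp: rcis_def intro!: continuous_intros\<close>)

lemma continuous_on_circle:
  fixes f :: "complex \<Rightarrow> 'a::topological_space"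
  assumes "continuous_on S f" "\<And>\<phi>. rcis r \<phi> \<in> S"
  shows "continuous_on T (\<lambda>\<phi>. f (rcis r \<phi>))"
  by (rule continuous_on_compose2[OF assms(1)])
    (use assms(2) in \<open>auto simp: rcis_def intro!: continuous_intros\<close>)

text \<open>
  The coefficients are Lebesgue integrals by definition; on circles where the function is continuous
  they can be handled as gauge integrals, for which differentiation under the integral sign and the
  fundamental theorem of calculus are stated.
\<close>

lemma ang_coeff_eq_integral:
  assumes "continuous_on S f" "\<And>\<phi>. rcis r \<phi> \<in> S"
  shows "ang_coeff f k r =
    1 / (2 * pi) * integral {0..2*pi} (\<lambda>\<phi>. of_real (f (rcis r \<phi>)) * cis (- (of_int k * \<phi>)))"
proof -
  have "continuous_on {0..2*pi} (\<lambda>\<phi>. of_real (f (rcis r \<phi>)) * cis (- (of_int k * \<phi>)))"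
    by (intro continuous_intros continuous_on_circle[OF assms])
  then show ?thesis
    unfolding ang_coeff_def
    by (subst set_lebesgue_integral_eq_integral) (auto intro: absolutely_integrable_continuous_real)
qed

text \<open>
  The partial derivatives are defined as derivatives along the axes. They determine the total
  derivative where that exists.
\<close>

lemma has_derivative_partials:
  assumes "f differentiable (at z)"
  shows "(f has_derivative (\<lambda>h. Re h * partial_x1 f z + Im h * partial_x2 f z)) (at z)"
proof -
  from assms obtain D where D: "(f has_derivative D) (at z)"
    by (auto simp: differentiable_def)
  have lin: "linear D"
    using D by (rule has_derivative_linear)
  have along: "deriv (\<lambda>s::real. f (z + u * of_real s)) 0 = D u" for u
  proof (rule DERIV_imp_deriv)
    have "((\<lambda>s::real. z + u * of_real s) has_derivative (\<lambda>s. u * of_real s)) (at 0)"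
      by (auto intro!: derivative_eq_intros)
    moreover have "(f has_derivative D) (at (z + u * of_real 0))"
      using D by simp
    ultimately have "((\<lambda>s::real. f (z + u * of_real s)) has_derivative (\<lambda>s. D (u * of_real s))) (at 0)"
      by (rule has_derivative_compose)
    moreover have "D (u * of_real s) = D u * s" for s
      using linear_cmul[OF lin, of s u] by (simp add: scaleR_conv_of_real mult.commute)
    ultimately show "((\<lambda>s::real. f (z + u * of_real s)) has_real_derivative D u) (at 0)"
      by (simp add: has_field_derivative_def)
  qed
  have "D h = Re h * D 1 + Im h * D \<i>" for h
  proof -
    have "h = Re h *\<^sub>R 1 + Im h *\<^sub>R \<i>"
      by (simp add: complex_eq_iff)
    then have "D h = D (Re h *\<^sub>R 1 + Im h *\<^sub>R \<i>)"
      by simp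
    then show ?thesis
      by (simp add: linear_add[OF lin] linear_cmul[OF lin])
  qed
  moreover have "D 1 = partial_x1 f z" "D \<i> = partial_x2 f z"
    using along[of 1] along[of \<i>] by (simp_all add: partial_x1_def partial_x2_def)
  ultimately have "D = (\<lambda>h. Re h * partial_x1 f z + Im h * partial_x2 f z)"
    by metis
  then show ?thesis
    using D by metis
qed

lemma has_vector_derivative_rcis:
  "((\<lambda>\<rho>. rcis \<rho> \<phi>) has_vector_derivative cis \<phi>) (at r)"
  "((\<lambda>\<theta>. rcis r \<theta>) has_vector_derivative \<i> * rcis r \<phi>) (at \<phi>)"
  unfolding has_vector_derivative_complex_iff
  by (auto intro!: derivative_eq_intros)

lemma has_real_derivative_along:
  fixes g :: "real \<Rightarrow> complex"
  assumes "f differentiable (at (g x))" "(g has_vector_derivative g') (at x)"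
  shows "((\<lambda>x. f (g x)) has_real_derivative
     (Re g' * partial_x1 f (g x) + Im g' * partial_x2 f (g x))) (at x)"
  using has_derivative_compose[OF assms(2)[unfolded has_vector_derivative_def] has_derivative_partials[OF assms(1)]]
  unfolding has_field_derivative_def
  by (rule has_derivative_eq_rhs) (simp add: fun_eq_iff algebra_simps)

context
  fixes f :: "complex \<Rightarrow> real" and r0 :: real
  assumes r0: "r0 > 0"
    and diff: "\<And>z. z \<in> exterior r0 \<Longrightarrow> f differentiable (at z)"
    and cont1: "continuous_on (exterior r0) (partial_x1 f)"
    and cont2: "continuous_on (exterior r0) (partial_x2 f)"
begin

lemma continuous_on_exterior: "continuous_on (exterior r0) f"
  using diff by (intro differentiable_imp_continuous_on) 
    (auto simp: differentiable_on_def intro: differentiable_at_withinI)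

lemma rcis_exterior: "r > r0 \<Longrightarrow> rcis r \<phi> \<in> exterior r0"
  using r0 by (simp add: exterior_def)

text \<open>
  Differentiation under the integral sign.
\<close>

lemma ang_coeff_has_radial_derivative:
  assumes "r > r0"
  shows "(ang_coeff f j has_vector_derivative 1 / (2 * pi) * integral {0..2*pi} (\<lambda>\<phi>.
      of_real (cos \<phi> * partial_x1 f (rcis r \<phi>) + sin \<phi> * partial_x2 f (rcis r \<phi>)) * cis (- (of_int j * \<phi>)))) (at r)"
proof -
  let ?g = "\<lambda>r \<phi>. of_real (f (rcis r \<phi>)) * cis (- (of_int j * \<phi>))"
  let ?g' = "\<lambda>r \<phi>. of_real (cos \<phi> * partial_x1 f (rcis r \<phi>) + sin \<phi> * partial_x2 f (rcis r \<phi>)) * cis (- (of_int j * \<phi>))"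
  have "((\<lambda>r. integral (cbox 0 (2*pi)) (?g r)) has_vector_derivative integral (cbox 0 (2*pi)) (?g' r)) (at r within {r0<..})"
  proof (rule leibniz_rule_vector_derivative)
    fix r \<phi> assume r: "r \<in> {r0<..}"
    then have "rcis r \<phi> \<in> exterior r0"
      by (intro rcis_exterior) simp
    then have "((\<lambda>r. f (rcis r \<phi>)) has_real_derivative
        (cos \<phi> * partial_x1 f (rcis r \<phi>) + sin \<phi> * partial_x2 f (rcis r \<phi>))) (at r)"
      by (intro DERIV_cong[OF has_real_derivative_along[OF diff has_vector_derivative_rcis(1)]]) simp_all
    then show "((\<lambda>r. ?g r \<phi>) has_vector_derivative ?g' r \<phi>) (at r within {r0<..})"
      by (intro has_vector_derivative_at_within[OF has_vector_derivative_mult_left] has_vector_derivative_of_real)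
  next
    fix r assume r: "r \<in> {r0<..}"
    then show "?g r integrable_on cbox 0 (2*pi)"
      unfolding box_real
      by (intro integrable_continuous_real continuous_intros continuous_on_circle[OF continuous_on_exterior] rcis_exterior) auto
  next
    have 1: "continuous_on ({r0<..} \<times> {0..2*pi}) (\<lambda>(r, \<phi>). partial_x1 f (rcis r \<phi>))"
      "continuous_on ({r0<..} \<times> {0..2*pi}) (\<lambda>(r, \<phi>). partial_x2 f (rcis r \<phi>))"
      by (intro continuous_on_ring[OF cont1] continuous_on_ring[OF cont2] rcis_exterior; simp)+
    show "continuous_on ({r0<..} \<times> cbox 0 (2*pi)) (\<lambda>(r, \<phi>). ?g' r \<phi>)"
      using 1 unfolding split_def box_real by (intro continuous_intros) auto
  qed (use assms in auto)
  then have "((\<lambda>r. integral {0..2*pi} (?g r)) has_vector_derivative integral {0..2*pi} (?g' r)) (at r)"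
    using assms by (simp add: at_within_open[of r "{r0<..}"])
  then have *: "((\<lambda>r. 1 / (2*pi) * integral {0..2*pi} (?g r)) has_vector_derivative
      1 / (2*pi) * integral {0..2*pi} (?g' r)) (at r)"
    by (rule has_vector_derivative_mult_right)
  show ?thesis
    by (rule has_vector_derivative_transform_within_open[OF *, of "{r0<..}"])
      (use assms in \<open>auto simp: ang_coeff_eq_integral[OF continuous_on_exterior rcis_exterior]\<close>)
qed

text \<open>
  Integration by parts over a full period: the function and the character take the same values at
  both ends.
\<close>

lemma ang_coeff_angular_derivative:
  assumes "r > r0"
  shows "1 / (2 * pi) * integral {0..2*pi} (\<lambda>\<phi>.
      of_real (- sin \<phi> * partial_x1 f (rcis r \<phi>) + cos \<phi> * partial_x2 f (rcis r \<phi>)) * cis (- (of_int j * \<phi>)))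
      = \<i> * of_int j / of_real r * ang_coeff f j r"
proof -
  let ?h = "\<lambda>\<phi>. of_real (f (rcis r \<phi>)) * cis (- (of_int j * \<phi>)) :: complex"
  let ?d = "\<lambda>\<phi>. of_real (- sin \<phi> * partial_x1 f (rcis r \<phi>) + cos \<phi> * partial_x2 f (rcis r \<phi>)) * cis (- (of_int j * \<phi>)) :: complex"
  have hd: "(?h has_vector_derivative of_real r * ?d \<phi> - \<i> * of_int j * ?h \<phi>) (at \<phi>)" for \<phi>
  proof -
    have f: "((\<lambda>\<phi>. f (rcis r \<phi>)) has_real_derivative
        r * (- sin \<phi> * partial_x1 f (rcis r \<phi>) + cos \<phi> * partial_x2 f (rcis r \<phi>))) (at \<phi>)"
      by (rule DERIV_cong[OF has_real_derivative_along[OF diff[OF rcis_exterior[OF assms]] has_vector_derivative_rcis(2)]])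
        (simp add: algebra_simps)
    have e: "((\<lambda>\<phi>. cis (- (of_int j * \<phi>))) has_vector_derivative - \<i> * of_int j * cis (- (of_int j * \<phi>))) (at \<phi>)"
      unfolding has_vector_derivative_complex_iff by (auto intro!: derivative_eq_intros)
    show ?thesis
      by (rule has_vector_derivative_eq_rhs[OF has_vector_derivative_mult[OF has_vector_derivative_of_real[OF f] e]])
        (simp add: algebra_simps)
  qed
  have "((\<lambda>\<phi>. of_real r * ?d \<phi> - \<i> * of_int j * ?h \<phi>) has_integral ?h (2*pi) - ?h 0) {0..2*pi}"
    by (rule fundamental_theorem_of_calculus) (simp, rule has_vector_derivative_at_within[OF hd])
  moreover have "?h (2*pi) = ?h 0"
  proof -
    have "- (of_int j * (2*pi)) = 2*pi * of_int (- j)"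
      by simp
    then have "cis (- (of_int j * (2*pi))) = 1"
      by (metis Ints_of_int cis_multiple_2pi)
    then show ?thesis by (simp add: rcis_def)
  qed
  ultimately have 0: "((\<lambda>\<phi>. of_real r * ?d \<phi> - \<i> * of_int j * ?h \<phi>) has_integral 0) {0..2*pi}"
    by simp
  have h: "?h integrable_on {0..2*pi}"
    using assms by (intro integrable_continuous_real continuous_intros continuous_on_circle[OF continuous_on_exterior] rcis_exterior)
  have d: "?d integrable_on {0..2*pi}"
    using assms by (intro integrable_continuous_real continuous_intros continuous_on_circle[OF cont1] 
       continuous_on_circle[OF cont2] rcis_exterior)
  define D H where "D = integral {0..2*pi} ?d" and "H = integral {0..2*pi} ?h"
  have "of_real r * D - \<i> * of_int j * H = 0"
    unfolding D_def H_def
  proof (rule has_integral_unique)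
    show "((\<lambda>\<phi>. of_real r * ?d \<phi> - \<i> * of_int j * ?h \<phi>) has_integral
       of_real r * integral {0..2*pi} ?d - \<i> * of_int j * integral {0..2*pi} ?h) {0..2*pi}"
      by (intro has_integral_diff has_integral_mult_right integrable_integral h d)
  qed (rule 0)
  then have "D = \<i> * of_int j / of_real r * H"
    using assms r0 by (simp add: field_simps)
  then have "1 / (2 * pi) * D = \<i> * of_int j / of_real r * (1 / (2 * pi) * H)"
    by simp
  then show ?thesis
    unfolding D_def H_def ang_coeff_eq_integral[OF continuous_on_exterior rcis_exterior[OF assms]] .
qed

lemma integrable_on_circle:
  assumes "r > r0" "continuous_on (exterior r0) g" "continuous_on UNIV e"
  shows "(\<lambda>\<phi>. of_real (g (rcis r \<phi>)) * e \<phi> :: complex) integrable_on {0..2*pi}"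
  using assms by (intro integrable_continuous_real continuous_intros continuous_on_circle[OF assms(2)] rcis_exterior)
    (auto intro: continuous_on_subset)

text \<open>
  In polar coordinates $\partial_{x_1} \pm i \partial_{x_2} = e^{\pm i\varphi}
  (\partial_r \pm \frac{i}{r} \partial_\varphi)$. The factor $e^{\pm i\varphi}$ shifts the index by
  one, and $\partial_\varphi$ acts on the $j$-th coefficient as multiplication by $ij$.
\<close>

lemma ang_coeff_wirtinger:
  assumes r: "r > r0"
  defines "w' \<equiv> \<lambda>j. vector_derivative (ang_coeff f j) (at r)"
  shows "w' j - of_int j / of_real r * ang_coeff f j r
          = ang_coeff (partial_x1 f) (j + 1) r + \<i> * ang_coeff (partial_x2 f) (j + 1) r" (is ?A)
    and "w' j + of_int j / of_real r * ang_coeff f j r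
          = ang_coeff (partial_x1 f) (j - 1) r - \<i> * ang_coeff (partial_x2 f) (j - 1) r" (is ?B)
proof -
  let ?P = "\<lambda>\<phi>. partial_x1 f (rcis r \<phi>)" and ?Q = "\<lambda>\<phi>. partial_x2 f (rcis r \<phi>)"
  let ?I = "integral {0..2*pi}"
  let ?e = "\<lambda>j \<phi>. cis (- (of_int j * \<phi>))"
  let ?R = "\<lambda>\<phi>. of_real (cos \<phi> * ?P \<phi> + sin \<phi> * ?Q \<phi>) * ?e j \<phi>"
  let ?T = "\<lambda>\<phi>. of_real (- sin \<phi> * ?P \<phi> + cos \<phi> * ?Q \<phi>) * ?e j \<phi>"
  have R: "w' j = 1 / (2*pi) * ?I ?R"
    unfolding w'_def by (rule vector_derivative_at[OF ang_coeff_has_radial_derivative[OF r]])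
  have T: "of_int j / of_real r * ang_coeff f j r = - \<i> * (1 / (2*pi) * ?I ?T)"
    unfolding ang_coeff_angular_derivative[OF r] by (simp add: field_simps)
  have iR: "?R integrable_on {0..2*pi}" and iT: "?T integrable_on {0..2*pi}"
    by (intro integrable_continuous_real continuous_intros continuous_on_circle[OF cont1]
       continuous_on_circle[OF cont2] rcis_exterior[OF r])+
  have iP: "(\<lambda>\<phi>. of_real (?P \<phi>) * ?e m \<phi>) integrable_on {0..2*pi}" and iQ: "(\<lambda>\<phi>. of_real (?Q \<phi>) * ?e m \<phi>) integrable_on {0..2*pi}" for m
    by (intro integrable_on_circle r cont1 cont2 continuous_intros)+
  have P: "ang_coeff (partial_x1 f) m r = 1 / (2*pi) * ?I (\<lambda>\<phi>. of_real (?P \<phi>) * ?e m \<phi>)"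
    and Q: "ang_coeff (partial_x2 f) m r = 1 / (2*pi) * ?I (\<lambda>\<phi>. of_real (?Q \<phi>) * ?e m \<phi>)" for m
    using r by (simp_all add: ang_coeff_eq_integral[OF cont1 rcis_exterior] ang_coeff_eq_integral[OF cont2 rcis_exterior])
  have e: "?e (j + 1) \<phi> = ?e j \<phi> * cis (- \<phi>)" "?e (j - 1) \<phi> = ?e j \<phi> * cis \<phi>" for \<phi>
    by (simp_all add: cis_mult algebra_simps)
  have "of_real (cos \<phi> * p + sin \<phi> * q) + \<i> * of_real (- sin \<phi> * p + cos \<phi> * q)
      = (of_real p + \<i> * of_real q) * cis (- \<phi>)"
    and "of_real (cos \<phi> * p + sin \<phi> * q) - \<i> * of_real (- sin \<phi> * p + cos \<phi> * q)
      = (of_real p - \<i> * of_real q) * cis \<phi>" for p q \<phi> :: real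
    by (simp_all add: complex_eq_iff algebra_simps)
  note base = this
  have "A * E + \<i> * (B * E) = (A + \<i> * B) * E" "A * E - \<i> * (B * E) = (A - \<i> * B) * E"
    "(A + \<i> * B) * C * E = A * (E * C) + \<i> * (B * (E * C))"
    "(A - \<i> * B) * C * E = A * (E * C) - \<i> * (B * (E * C))" for A B C E
    by (simp_all add: algebra_simps)
  then have rot: "?R \<phi> + \<i> * ?T \<phi> = of_real (?P \<phi>) * ?e (j + 1) \<phi> + \<i> * (of_real (?Q \<phi>) * ?e (j + 1) \<phi>)"
    "?R \<phi> - \<i> * ?T \<phi> = of_real (?P \<phi>) * ?e (j - 1) \<phi> - \<i> * (of_real (?Q \<phi>) * ?e (j - 1) \<phi>)" for \<phi>
    unfolding e using base by metis+
  have "1 * ?I ?R + c * ?I ?T = 1 * ?I (\<lambda>\<phi>. of_real (?P \<phi>) * ?e (j+m) \<phi>) + c * ?I (\<lambda>\<phi>. of_real (?Q \<phi>) * ?e (j+m) \<phi>)"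
    if "c = \<i> \<and> m = 1 \<or> c = - \<i> \<and> m = - 1" for c m
    unfolding integral_lincomb[OF iR iT, symmetric] integral_lincomb[OF iP iQ, symmetric]
    by (intro integral_cong) (use that rot in auto)
  from this[of \<i> 1] this[of "- \<i>" "- 1"]
  show ?A and ?B
    unfolding R T P Q by (simp_all add: field_simps)
qed

text \<open>
  With $V = v_x + i v_y$, the drift operator is
  $\frac12 \bar V (\partial_{x_1} + i \partial_{x_2}) + \frac12 V (\partial_{x_1} - i \partial_{x_2})$,
  and the coefficients of its two halves are given by the preceding lemma at $j = k - 1$ and
  $j = k + 1$; the weights $\bar V / 2$ and $V / 2$ are the Fourier coefficients of the radial
  component of the drift velocity.
\<close>

lemma ang_coeff_drift:
  assumes r: "r > r0"
  defines "w' \<equiv> \<lambda>j. vector_derivative (ang_coeff f j) (at r)"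
  shows "ang_coeff (drift vx vy f) k r =
    v_rad vx vy 1 * (w' (k - 1) - of_int (k - 1) / of_real r * ang_coeff f (k - 1) r)
    + v_rad vx vy (- 1) * (w' (k + 1) + of_int (k + 1) / of_real r * ang_coeff f (k + 1) r)"
proof -
  let ?P = "\<lambda>\<phi>. partial_x1 f (rcis r \<phi>)" and ?Q = "\<lambda>\<phi>. partial_x2 f (rcis r \<phi>)"
  let ?I = "integral {0..2*pi}"
  let ?e = "\<lambda>\<phi>. cis (- (of_int k * \<phi>))"
  have iP: "(\<lambda>\<phi>. of_real (?P \<phi>) * ?e \<phi>) integrable_on {0..2*pi}" and iQ: "(\<lambda>\<phi>. of_real (?Q \<phi>) * ?e \<phi>) integrable_on {0..2*pi}"
    by (intro integrable_on_circle r cont1 cont2 continuous_intros)+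
  have cd: "continuous_on (exterior r0) (drift vx vy f)"
    unfolding drift_def by (intro continuous_intros cont1 cont2)
  have "?I (\<lambda>\<phi>. of_real (drift vx vy f (rcis r \<phi>)) * ?e \<phi>) =
     ?I (\<lambda>\<phi>. of_real vx * (of_real (?P \<phi>) * ?e \<phi>) + of_real vy * (of_real (?Q \<phi>) * ?e \<phi>))"
    by (intro integral_cong) (simp add: drift_def algebra_simps)
  also have "\<dots> = of_real vx * ?I (\<lambda>\<phi>. of_real (?P \<phi>) * ?e \<phi>) + of_real vy * ?I (\<lambda>\<phi>. of_real (?Q \<phi>) * ?e \<phi>)"
    by (rule integral_lincomb[OF iP iQ])
  finally have "ang_coeff (drift vx vy f) k r =
     of_real vx * ang_coeff (partial_x1 f) k r + of_real vy * ang_coeff (partial_x2 f) k r"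
    using r by (simp add: ang_coeff_eq_integral[OF cd rcis_exterior] ang_coeff_eq_integral[OF cont1 rcis_exterior]
      ang_coeff_eq_integral[OF cont2 rcis_exterior] field_simps)
  then show ?thesis
    unfolding w'_def ang_coeff_wirtinger[OF r] by (simp add: v_rad_def field_simps)
qed

end

section \<open>Uniqueness for the hierarchy of moments\<close>

text \<open>
  Induction on the number $n$ of integrations. Inserting the bound for index $k + 1$ into the
  equation for $\mu_k$ gives a factor $k {k+n \choose n}$ and the integral of $(t-s)^n$ a factor
  $1/(n+1)$; together they make ${k+n \choose n+1}$.
\<close>

lemma hierarchy_iterated_bound:
  fixes \<mu> :: "nat \<Rightarrow> real \<Rightarrow> complex" and V :: complex
  assumes r0: "r0 > 0"
    and cont: "\<And>k. continuous_on {s..T} (\<mu> k)"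
    and deriv: "\<And>k t. s < t \<Longrightarrow> t < T \<Longrightarrow>
      (\<mu> k has_vector_derivative - of_nat k * V * \<mu> (Suc k) t) (at t)"
    and bound: "\<And>k t. s \<le> t \<Longrightarrow> t \<le> T \<Longrightarrow> norm (\<mu> k t) \<le> C / r0 ^ k"
    and zero: "\<And>k. k \<ge> 2 \<Longrightarrow> \<mu> k s = 0"
    and k: "k \<ge> 2" and t: "s \<le> t" "t \<le> T"
  shows "norm (\<mu> k t) \<le> C / r0 ^ (k + n) * norm V ^ n * real ((k + n - 1) choose n) * (t - s) ^ n"
  using k t
proof (induction n arbitrary: k t)
  case 0
  then show ?case using bound by simp
next
  case (Suc n)
  define K where "K = C / r0 ^ (k + Suc n) * norm V ^ Suc n * real ((k + n) choose Suc n)"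
  show ?case
  proof (cases "s = t")
    case True
    then show ?thesis using zero Suc.prems by simp
  next
    case False
    then have "s < t" using Suc.prems by simp
    have binom: "real k * real ((k + n) choose n) = real (Suc n) * real ((k + n) choose Suc n)"
    proof -
      have "Suc n * ((k + n) choose Suc n) = (k + n - n) * ((k + n) choose n)"
        by (metis binomial_absorb_comp binomial_absorption add_diff_cancel_right' mult.commute)
      then show ?thesis
        by (simp only: add_diff_cancel_right' flip: of_nat_mult)
    qed
    have "norm (\<mu> k t - \<mu> k s) \<le> K * (t - s) ^ Suc n - K * (s - s) ^ Suc n"
    proof (rule differentiable_bound_general[OF \<open>s < t\<close>])
      show "continuous_on {s..t} (\<mu> k)"
        using cont Suc.prems by (metis atLeastatMost_subset_iff continuous_on_subset order_refl)
      show "continuous_on {s..t} (\<lambda>x. K * (x - s) ^ Suc n)"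
        by (intro continuous_intros)
      fix x assume x: "s < x" "x < t"
      show "(\<mu> k has_vector_derivative - of_nat k * V * \<mu> (Suc k) x) (at x)"
        using deriv x Suc.prems by simp
      show "((\<lambda>x. K * (x - s) ^ Suc n) has_vector_derivative K * (real (Suc n) * (x - s) ^ n)) (at x)"
        unfolding has_real_derivative_iff_has_vector_derivative[symmetric]
        by (auto intro!: derivative_eq_intros simp del: power_Suc)
      have "norm (- of_nat k * V * \<mu> (Suc k) x) = real k * norm V * norm (\<mu> (Suc k) x)"
        by (simp add: norm_mult)
      also have "\<dots> \<le> real k * norm V * (C / r0 ^ (Suc k + n) * norm V ^ n *
          real ((Suc k + n - 1) choose n) * (x - s) ^ n)"
        using Suc.IH[of "Suc k" x] Suc.prems x by (intro mult_left_mono) auto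
      also have "\<dots> = C / r0 ^ (k + Suc n) * norm V ^ Suc n * (real k * real ((k + n) choose n)) * (x - s) ^ n"
        by (simp add: mult_ac)
      also have "\<dots> = K * (real (Suc n) * (x - s) ^ n)"
        unfolding binom K_def by (simp add: mult_ac)
      finally show "norm (- of_nat k * V * \<mu> (Suc k) x) \<le> K * (real (Suc n) * (x - s) ^ n)" .
    qed
    then show ?thesis
      using zero Suc.prems by (simp add: K_def)
  qed
qed

text \<open>
  Since ${k+n-1 \choose n} \le 2^{k+n}$, the iterated bound decays geometrically as soon as
  $2 |V| (t - s) / r_0 \le 1/2$. The admissible length of the time interval does not depend on the
  size $C$ of the moments, so the argument can be repeated on consecutive intervals.
\<close>

lemma hierarchy_short_time:
  fixes \<mu> :: "nat \<Rightarrow> real \<Rightarrow> complex" and V :: complex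
  assumes r0: "r0 > 0"
    and cont: "\<And>k. continuous_on {s..T} (\<mu> k)"
    and deriv: "\<And>k t. s < t \<Longrightarrow> t < T \<Longrightarrow>
      (\<mu> k has_vector_derivative - of_nat k * V * \<mu> (Suc k) t) (at t)"
    and bound: "\<And>k t. s \<le> t \<Longrightarrow> t \<le> T \<Longrightarrow> norm (\<mu> k t) \<le> C / r0 ^ k"
    and zero: "\<And>k. k \<ge> 2 \<Longrightarrow> \<mu> k s = 0"
    and small: "4 * norm V * (T - s) \<le> r0"
    and k: "k \<ge> 2" and t: "s \<le> t" "t \<le> T"
  shows "\<mu> k t = 0"
proof -
  have "0 \<le> C / r0 ^ k"
    using bound[OF t] norm_ge_zero order_trans by blast
  then have C: "0 \<le> C"
    using r0 by (metis divide_less_0_iff not_le zero_less_power)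
  have est: "norm (\<mu> k t) \<le> C * 2 ^ k / r0 ^ k * (1/2) ^ n" for n
  proof -
    have "norm V * (t - s) \<le> norm V * (T - s)"
      using t by (intro mult_left_mono) auto
    then have "2 * (norm V * (t - s) / r0) \<le> 1/2"
      using small r0 by (simp add: field_simps)
    moreover have "0 \<le> 2 * (norm V * (t - s) / r0)"
      using t r0 by simp
    ultimately have pow: "(2 * (norm V * (t - s) / r0)) ^ n \<le> (1/2) ^ n"
      by (rule power_mono)
    have "((k + n - 1) choose n) \<le> 2 ^ (k + n - 1)"
      by (rule binomial_le_pow2)
    also have "\<dots> \<le> 2 ^ (k + n)"
      by (rule power_increasing) auto
    finally have ch: "real ((k + n - 1) choose n) \<le> 2 ^ (k + n)"
      by (metis of_nat_le_iff of_nat_numeral of_nat_power)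
    have "norm (\<mu> k t) \<le> C / r0 ^ (k + n) * norm V ^ n * real ((k + n - 1) choose n) * (t - s) ^ n"
      by (rule hierarchy_iterated_bound[OF r0 cont deriv bound zero k t])
    also have "\<dots> \<le> C / r0 ^ (k + n) * norm V ^ n * 2 ^ (k + n) * (t - s) ^ n"
      using ch C r0 t by (intro mult_right_mono mult_left_mono) auto
    also have "\<dots> = C * 2 ^ k / r0 ^ k * (2 * (norm V * (t - s) / r0)) ^ n"
      using r0 unfolding power_mult_distrib power_divide by (simp add: power_add)
    also have "\<dots> \<le> C * 2 ^ k / r0 ^ k * (1/2) ^ n"
      using pow C r0 by (intro mult_left_mono) auto
    finally show ?thesis .
  qed
  have "(\<lambda>n. C * 2 ^ k / r0 ^ k * (1/2) ^ n) \<longlonglongrightarrow> C * 2 ^ k / r0 ^ k * 0"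
    by (intro tendsto_intros LIMSEQ_realpow_zero) auto
  then have "norm (\<mu> k t) \<le> C * 2 ^ k / r0 ^ k * 0"
    by (rule LIMSEQ_le_const) (use est in auto)
  then show ?thesis by simp
qed

text \<open>
  Vanishing of the moments of order at least two propagates through steps of a fixed length; the
  equations for orders zero and one then have right-hand side zero.
\<close>

lemma hierarchy_unique:
  fixes \<mu> :: "nat \<Rightarrow> real \<Rightarrow> complex" and V :: complex
  assumes r0: "r0 > 0"
    and cont: "\<And>k. continuous_on {0..} (\<mu> k)"
    and deriv: "\<And>k t. 0 < t \<Longrightarrow> (\<mu> k has_vector_derivative - of_nat k * V * \<mu> (Suc k) t) (at t)"
    and bound: "\<And>T. \<exists>C. \<forall>k. \<forall>t\<in>{0..T}. norm (\<mu> k t) \<le> C / r0 ^ k"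
    and zero: "\<And>k. k \<ge> 2 \<Longrightarrow> \<mu> k 0 = 0"
    and t: "0 \<le> t"
  shows "\<mu> k t = \<mu> k 0"
proof -
  define \<delta> where "\<delta> = r0 / (4 * (norm V + 1))"
  have \<delta>: "\<delta> > 0" "4 * norm V * \<delta> \<le> r0"
  proof -
    have pos: "0 < 4 * (norm V + 1)"
      by (intro mult_pos_pos add_nonneg_pos) auto
    then show "\<delta> > 0"
      using r0 by (simp add: \<delta>_def)
    then show "4 * norm V * \<delta> \<le> r0"
      using pos by (simp add: \<delta>_def field_simps)
  qed
  have steps: "\<forall>k\<ge>2. \<forall>t\<in>{0..of_nat n * \<delta>}. \<mu> k t = 0" for n
  proof (induction n)
    case 0
    then show ?case using zero by auto
  next
    case (Suc n)
    show ?case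
    proof (intro allI impI ballI)
      fix k t assume k: "2 \<le> (k::nat)" and t: "t \<in> {0..of_nat (Suc n) * \<delta>}"
      show "\<mu> k t = 0"
      proof (cases "t \<le> of_nat n * \<delta>")
        case True
        then show ?thesis using Suc k t by auto
      next
        case False
        obtain C where C: "\<forall>k. \<forall>t\<in>{0..of_nat (Suc n) * \<delta>}. norm (\<mu> k t) \<le> C / r0 ^ k"
          using bound by blast
        have n\<delta>: "0 \<le> of_nat n * \<delta>" using \<delta> by simp
        show ?thesis
        proof (rule hierarchy_short_time[OF r0, where s = "of_nat n * \<delta>" and T = "of_nat (Suc n) * \<delta>" and V = V])
          show "continuous_on {of_nat n * \<delta>..of_nat (Suc n) * \<delta>} (\<mu> k)" for k
            using n\<delta> by (intro continuous_on_subset[OF cont]) auto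
          show "(\<mu> k has_vector_derivative - of_nat k * V * \<mu> (Suc k) x) (at x)"
            if "of_nat n * \<delta> < x" "x < of_nat (Suc n) * \<delta>" for x k
            using deriv that n\<delta> by simp
          show "norm (\<mu> k x) \<le> C / r0 ^ k"
            if "of_nat n * \<delta> \<le> x" "x \<le> of_nat (Suc n) * \<delta>" for x k
            using C that n\<delta> by simp
          show "\<mu> k (of_nat n * \<delta>) = 0" if "2 \<le> k" for k
            using Suc that n\<delta> by simp
          show "4 * norm V * (of_nat (Suc n) * \<delta> - of_nat n * \<delta>) \<le> r0"
            using \<delta> by (simp add: algebra_simps)
        qed (use k t False in auto)
      qed
    qed
  qed
  have van: "\<mu> k t = 0" if "k \<ge> 2" "0 \<le> t" for k t
  proof -
    obtain n where "t < of_nat n * \<delta>"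
      using reals_Archimedean3[OF \<delta>(1)] by metis
    then show ?thesis using steps[of n] that by auto
  qed
  show ?thesis
  proof (cases "k \<ge> 2")
    case True
    then show ?thesis using van t by simp
  next
    case False
    have *: "norm (\<mu> k t - \<mu> k 0) \<le> 0 - 0" if "0 < t"
    proof (rule differentiable_bound_general[OF that])
      show "continuous_on {0..t} (\<mu> k)"
        by (rule continuous_on_subset[OF cont]) auto
      fix x assume x: "0 < x" "x < t"
      show "(\<mu> k has_vector_derivative - of_nat k * V * \<mu> (Suc k) x) (at x)"
        using deriv x by simp
      have "k = 0 \<or> Suc k \<ge> 2" by linarith
      then show "norm (- of_nat k * V * \<mu> (Suc k) x) \<le> 0"
        using van[of "Suc k" x] x by auto
    qed auto
    then show ?thesis
      using t by (cases "t = 0") auto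
  qed
qed

section \<open>Weighted integrals of Fourier coefficients\<close>

text \<open>
  Integration of the function against \<open>c (norm z) * (sgn z) powi (- j)\<close> in polar coordinates, where
  \<open>sgn z\<close> is the unit vector $e^{i\varphi}$.
\<close>

lemma annulus_weighted_ang_coeff:
  assumes a: "0 < a" and f: "continuous_on (annulus a b) f" and c: "continuous_on {a..b} c"
  shows "((\<lambda>z. of_real (c (norm z) * f z) * sgn z powi (- j)) has_integral
            2 * pi * integral {a..b} (\<lambda>r. of_real (r * c r) * ang_coeff f j r)) (annulus a b)"
proof -
  let ?h = "\<lambda>z. of_real (c (norm z) * f z) * sgn z powi (- j)"
  have "continuous_on (annulus a b) ?h"
    using a by (intro continuous_intros f continuous_on_compose2[OF c] continuous_on_power_int)
      (auto simp: annulus_def sgn_zero_iff)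
  then have "(?h has_integral integral {a..b} (\<lambda>r. of_real r * integral {0..2*pi} (\<lambda>\<phi>. ?h (rcis r \<phi>)))) (annulus a b)"
    by (rule has_integral_polar_annulus[OF a])
  moreover have "of_real r * integral {0..2*pi} (\<lambda>\<phi>. ?h (rcis r \<phi>)) = 2 * pi * (of_real (r * c r) * ang_coeff f j r)"
    if r: "r \<in> {a..b}" for r
  proof -
    have "rcis r \<phi> \<in> annulus a b" for \<phi>
      using r a by (simp add: annulus_def)
    note ang = ang_coeff_eq_integral[OF f this]
    have "sgn (rcis r \<phi>) = cis \<phi>" for \<phi>
      using r a by (simp add: rcis_def sgn_mult sgn_of_real)
    moreover have "norm (rcis r \<phi>) = r" for \<phi>
      using r a by simp
    ultimately have "?h (rcis r \<phi>) = of_real (c r) * (of_real (f (rcis r \<phi>)) * cis (- (of_int j * \<phi>)))" for \<phi>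
      by (simp add: cis_power_int)
    then have "integral {0..2*pi} (\<lambda>\<phi>. ?h (rcis r \<phi>)) =
        of_real (c r) * integral {0..2*pi} (\<lambda>\<phi>. of_real (f (rcis r \<phi>)) * cis (- (of_int j * \<phi>)))"
      by (simp only: integral_mult_right)
    also have "\<dots> = of_real (c r) * (2 * pi * ang_coeff f j r)"
      unfolding ang by simp
    finally show ?thesis
      by (simp only: of_real_mult mult_ac)
  qed
  then have "integral {a..b} (\<lambda>r. of_real r * integral {0..2*pi} (\<lambda>\<phi>. ?h (rcis r \<phi>))) =
      integral {a..b} (\<lambda>r. 2 * pi * (of_real (r * c r) * ang_coeff f j r))"
    by (rule integral_cong)
  ultimately show ?thesis
    by (simp only: integral_mult_right)
qed

text \<open>
  A radial integral of a single coefficient is a planar integral of the function against a weight of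
  modulus $|c(|z|)|$, so the $L_1$ norm on the plane controls it.
\<close>

lemma annulus_ang_coeff_bound:
  assumes a: "0 < r0" "r0 < a" and f: "continuous_on (annulus a b) f" and c: "continuous_on {a..b} c"
    and f1: "set_integrable lebesgue (exterior r0) f"
    and B: "\<And>r. r \<in> {a..b} \<Longrightarrow> \<bar>c r\<bar> \<le> B" "0 \<le> B"
  shows "2 * pi * norm (integral {a..b} (\<lambda>r. of_real (r * c r) * ang_coeff f j r))
           \<le> B * integral (exterior r0) (\<lambda>z. \<bar>f z\<bar>)"
proof -
  let ?h = "\<lambda>z. of_real (c (norm z) * f z) * sgn z powi (- j)"
  have sub: "annulus a b \<subseteq> exterior r0"
    using a by (auto simp: annulus_def exterior_def)
  have f1': "(\<lambda>z. \<bar>f z\<bar>) integrable_on exterior r0"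
    using f1 by (simp add: absolutely_integrable_on_def)
  have fA: "(\<lambda>z. \<bar>f z\<bar>) integrable_on annulus a b"
  proof -
    have "closed (annulus a b)"
      unfolding annulus_def by (intro closed_Collect_conj closed_Collect_le continuous_intros)
    then have "annulus a b \<in> sets lebesgue"
      by (simp add: borel_closed sets_completionI_sets)
    then show ?thesis
      using set_integrable_subset[OF f1 _ sub] by (simp add: absolutely_integrable_on_def)
  qed
  have I: "(?h has_integral 2 * pi * integral {a..b} (\<lambda>r. of_real (r * c r) * ang_coeff f j r)) (annulus a b)"
    using a by (intro annulus_weighted_ang_coeff f c) simp
  have "2 * pi * norm (integral {a..b} (\<lambda>r. of_real (r * c r) * ang_coeff f j r)) = norm (integral (annulus a b) ?h)"
    unfolding integral_unique[OF I] by (simp add: norm_mult)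
  also have "\<dots> \<le> integral (annulus a b) (\<lambda>z. B * \<bar>f z\<bar>)"
  proof (rule integral_norm_bound_integral)
    show "?h integrable_on annulus a b" using I by blast
    show "(\<lambda>z. B * \<bar>f z\<bar>) integrable_on annulus a b" using fA by (intro integrable_on_mult_right)
    fix z assume z: "z \<in> annulus a b"
    then have "norm (sgn z powi (- j)) = 1"
      using a by (auto simp: norm_power_int norm_sgn annulus_def)
    then show "norm (?h z) \<le> B * \<bar>f z\<bar>"
      using B(1)[of "norm z"] z by (simp add: norm_mult abs_mult annulus_def mult_right_mono)
  qed
  also have "\<dots> = B * integral (annulus a b) (\<lambda>z. \<bar>f z\<bar>)"
    by simp
  also have "\<dots> \<le> B * integral (exterior r0) (\<lambda>z. \<bar>f z\<bar>)"
    by (intro mult_left_mono integral_subset_le sub fA f1' B(2)) auto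
  finally show ?thesis .
qed

section \<open>Radial cutoffs and truncated moments\<close>

text \<open>
  On $[a, a + L]$ the cutoff decreases from $1$ to $0$ with vanishing derivative at both ends, so that
  two integrations by parts leave no boundary term other than the flux at $a$.
\<close>

definition cutoff :: "real \<Rightarrow> real \<Rightarrow> real \<Rightarrow> real" where
  "cutoff a L r = (1 - ((r - a) / L)\<^sup>2)\<^sup>2"

definition cutoff' :: "real \<Rightarrow> real \<Rightarrow> real \<Rightarrow> real" where
  "cutoff' a L r = - 4 * ((r - a) / L) * (1 - ((r - a) / L)\<^sup>2) / L"

definition cutoff'' :: "real \<Rightarrow> real \<Rightarrow> real \<Rightarrow> real" where
  "cutoff'' a L r = (12 * ((r - a) / L)\<^sup>2 - 4) / L\<^sup>2"

lemma cutoff_ends: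
  assumes "L > 0"
  shows "cutoff a L a = 1" "cutoff a L (a + L) = 0" "cutoff' a L a = 0" "cutoff' a L (a + L) = 0"
  using assms by (simp_all add: cutoff_def cutoff'_def)

lemma cutoff_deriv:
  assumes "L > 0"
  shows "(cutoff a L has_real_derivative cutoff' a L r) (at r)"
    and "(cutoff' a L has_real_derivative cutoff'' a L r) (at r)"
proof -
  show "(cutoff a L has_real_derivative cutoff' a L r) (at r)"
    unfolding cutoff_def[abs_def] cutoff'_def using assms
    by (auto intro!: derivative_eq_intros simp: field_simps power2_eq_square)
  show "(cutoff' a L has_real_derivative cutoff'' a L r) (at r)"
    unfolding cutoff'_def[abs_def] cutoff''_def using assms
    by (auto intro!: derivative_eq_intros simp: field_simps power2_eq_square)
qed

lemma cutoff_continuous [continuous_intros]: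
  "L > 0 \<Longrightarrow> continuous_on S (cutoff a L)" "L > 0 \<Longrightarrow> continuous_on S (cutoff' a L)" "L > 0 \<Longrightarrow> continuous_on S (cutoff'' a L)"
  unfolding cutoff_def[abs_def] cutoff'_def[abs_def] cutoff''_def[abs_def] by (intro continuous_intros; simp)+

text \<open>
  Both derivatives are of order $1/L$ uniformly in the interval, the second one because
  $1/L^2 \le 1/L$ for $L \ge 1$.
\<close>

lemma cutoff_bounds:
  assumes "L \<ge> 1" "r \<in> {a..a + L}"
  shows "0 \<le> cutoff a L r" "cutoff a L r \<le> 1" "\<bar>cutoff' a L r\<bar> \<le> 4 / L" "\<bar>cutoff'' a L r\<bar> \<le> 12 / L"
proof -
  define x where "x = (r - a) / L"
  have x: "0 \<le> x" "x \<le> 1"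
    using assms by (auto simp: x_def field_simps)
  then have x2: "0 \<le> x\<^sup>2" "x\<^sup>2 \<le> 1"
    by (auto simp: power_le_one)
  show "0 \<le> cutoff a L r" "cutoff a L r \<le> 1"
    using x2 by (auto simp: cutoff_def power_le_one simp flip: x_def)
  have "x * (1 - x\<^sup>2) \<le> 1 * 1"
    using x x2 by (intro mult_mono) auto
  moreover have "0 \<le> x * (1 - x\<^sup>2)"
    using x x2 by simp
  ultimately have 1: "\<bar>- 4 * x * (1 - x\<^sup>2)\<bar> \<le> 4"
    by (simp add: abs_mult mult.assoc)
  show "\<bar>cutoff' a L r\<bar> \<le> 4 / L"
    using 1 assms(1) unfolding cutoff'_def x_def[symmetric] abs_divide
    by (intro frac_le) auto
  have "L * 1 \<le> L * L" using assms(1) by (intro mult_left_mono) auto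
  moreover have "\<bar>12 * x\<^sup>2 - 4\<bar> \<le> 12"
    by (rule abs_leI) (use x2 in linarith)+
  ultimately show "\<bar>cutoff'' a L r\<bar> \<le> 12 / L"
    using assms(1) unfolding cutoff''_def x_def[symmetric] abs_divide
    by (intro frac_le) (auto simp: power2_eq_square)
qed

lemma cutoff_tendsto:
  assumes "a \<longlonglongrightarrow> r0" "filterlim L at_top sequentially"
  shows "(\<lambda>n. cutoff (a n) (L n) r) \<longlonglongrightarrow> 1"
proof -
  have "(\<lambda>n. (1 - ((r - a n) / L n)\<^sup>2)\<^sup>2) \<longlonglongrightarrow> (1 - 0\<^sup>2)\<^sup>2"
    by (intro tendsto_intros real_tendsto_divide_at_top[OF tendsto_diff[OF tendsto_const assms(1)] assms(2)])
  then show ?thesis by (simp add: cutoff_def)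
qed

lemma exterior_sets [simp]: "exterior r0 \<in> sets lebesgue"
proof -
  have "open (exterior r0)"
    unfolding exterior_def by (intro open_Collect_less continuous_intros)
  then show ?thesis by (simp add: borel_open sets_completionI_sets)
qed

lemma exterior_moment_integrable:
  assumes r0: "0 < r0" and f: "set_integrable lebesgue (exterior r0) f"
  shows "set_integrable lebesgue (exterior r0) (\<lambda>z. of_real (f z) / z ^ k)"
proof -
  have "(\<lambda>z. f z *\<^sub>R (1 / z ^ k)) absolutely_integrable_on exterior r0" 
  proof -
    let ?h = "\<lambda>(z::complex) (x::real). x *\<^sub>R z"
    have "(\<lambda>z. ?h (1 / z ^ k) (f z)) absolutely_integrable_on exterior r0"
    proof (rule absolutely_integrable_bounded_measurable_product[where h = ?h, OF _ _ exterior_sets _ f])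
      show "bilinear (\<lambda>(z::complex) (x::real). x *\<^sub>R z)"
        by (auto intro!: linearI simp: bilinear_def scaleR_add_right scaleR_add_left)
      have "continuous_on (exterior r0) (\<lambda>z::complex. 1 / z ^ k)"
        using r0 by (intro continuous_intros) (auto simp: exterior_def)
      then show "(\<lambda>z::complex. 1 / z ^ k) \<in> borel_measurable (lebesgue_on (exterior r0))"
        by (rule continuous_imp_measurable_on_sets_lebesgue) simp
      show "bounded ((\<lambda>z. 1 / z ^ k) ` exterior r0)"
      proof (rule boundedI)
        fix y assume "y \<in> (\<lambda>z. 1 / z ^ k) ` exterior r0"
        then obtain z where "r0 < norm z" "y = 1 / z ^ k"
          by (auto simp: exterior_def)
        then show "norm y \<le> 1 / r0 ^ k"
          using r0 by (simp add: norm_divide norm_power frac_le power_mono)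
      qed
    qed
    then show ?thesis by simp
  qed
  then show ?thesis
    by (simp add: scaleR_conv_of_real)
qed

lemma exterior_moment_bound:
  assumes r0: "0 < r0" and f: "set_integrable lebesgue (exterior r0) f"
  shows "norm (integral (exterior r0) (\<lambda>z. of_real (f z) / z ^ k)) \<le> integral (exterior r0) (\<lambda>z. \<bar>f z\<bar>) / r0 ^ k"
proof -
  have "norm (integral (exterior r0) (\<lambda>z. of_real (f z) / z ^ k)) \<le> integral (exterior r0) (\<lambda>z. \<bar>f z\<bar> * (1 / r0 ^ k))"
  proof (rule integral_norm_bound_integral)
    show "(\<lambda>z. of_real (f z) / z ^ k) integrable_on exterior r0"
      using set_lebesgue_integral_eq_integral(1)[OF exterior_moment_integrable[OF assms]] .
    show "(\<lambda>z. \<bar>f z\<bar> * (1 / r0 ^ k)) integrable_on exterior r0"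
      using f by (intro integrable_on_mult_left) (simp add: absolutely_integrable_on_def)
    fix z assume "z \<in> exterior r0"
    then have "r0 ^ k \<le> norm z ^ k"
      using r0 by (intro power_mono) (auto simp: exterior_def)
    then show "norm (of_real (f z) / z ^ k) \<le> \<bar>f z\<bar> * (1 / r0 ^ k)"
      using r0 by (simp add: norm_divide norm_power frac_le)
  qed
  then show ?thesis by simp
qed

text \<open>
  The moment $\int f(z) z^{-k}\, dz$ with the cutoff inserted, in polar form.
\<close>

definition truncated_moment :: "real \<Rightarrow> real \<Rightarrow> nat \<Rightarrow> (complex \<Rightarrow> real) \<Rightarrow> complex" where
  "truncated_moment a L k f =
     2 * pi * integral {a..a + L} (\<lambda>r. of_real (r * (cutoff a L r / r ^ k)) * ang_coeff f (int k) r)"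

lemma truncated_moment_bound:
  assumes r0: "0 < r0" "r0 < a" and L: "1 \<le> L" and f: "continuous_on (annulus a (a + L)) f"
    and f1: "set_integrable lebesgue (exterior r0) f"
  shows "norm (truncated_moment a L k f) \<le> integral (exterior r0) (\<lambda>z. \<bar>f z\<bar>) / r0 ^ k"
proof -
  have "2 * pi * norm (integral {a..a + L} (\<lambda>r. of_real (r * (cutoff a L r / r ^ k)) * ang_coeff f (int k) r))
      \<le> 1 / r0 ^ k * integral (exterior r0) (\<lambda>z. \<bar>f z\<bar>)"
  proof (rule annulus_ang_coeff_bound[OF r0 f _ f1])
    show "continuous_on {a..a + L} (\<lambda>r. cutoff a L r / r ^ k)"
      using r0 L by (intro continuous_intros) auto
    show "\<bar>cutoff a L r / r ^ k\<bar> \<le> 1 / r0 ^ k" if r: "r \<in> {a..a + L}" for r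
      using cutoff_bounds(1,2)[OF L r] r r0 unfolding abs_divide
      by (intro frac_le) (auto simp: power_mono)
  qed (use r0 in auto)
  then show ?thesis
    by (simp add: truncated_moment_def norm_mult)
qed

text \<open>
  Dominated convergence in the plane. The polar form is first turned back into an integral over the
  annulus, because the hypothesis of integrability concerns the function and not its coefficients.
\<close>

lemma truncated_moment_tendsto:
  assumes r0: "0 < r0" and f: "continuous_on (exterior r0) f"
    and f1: "set_integrable lebesgue (exterior r0) f"
    and a: "\<And>n. r0 < a n" "a \<longlonglongrightarrow> r0" and L: "\<And>n. 1 \<le> L n" "filterlim L at_top sequentially"
  shows "(\<lambda>n. truncated_moment (a n) (L n) k f) \<longlonglongrightarrow> integral (exterior r0) (\<lambda>z. of_real (f z) / z ^ k)"
proof -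
  define g where "g n z = (if z \<in> annulus (a n) (a n + L n)
      then of_real (cutoff (a n) (L n) (norm z) * f z) / z ^ k else 0)" for n z
  have L0: "0 < L n" for n using L(1)[of n] by linarith
  have sub: "annulus (a n) (a n + L n) \<subseteq> exterior r0" for n
    using a(1)[of n] by (auto simp: annulus_def exterior_def)
  have gn: "(g n has_integral truncated_moment (a n) (L n) k f) (exterior r0)" for n
  proof -
    have an: "0 < a n" using a(1)[of n] r0 by linarith
    have "continuous_on {a n..a n + L n} (\<lambda>r. cutoff (a n) (L n) r / r ^ k)"
      using an L0 by (intro continuous_intros) auto
    from annulus_weighted_ang_coeff[OF an continuous_on_subset[OF f sub] this, of "int k"]
    have "((\<lambda>z. of_real (cutoff (a n) (L n) (norm z) / norm z ^ k * f z) * sgn z powi - int k) has_integral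
        truncated_moment (a n) (L n) k f) (annulus (a n) (a n + L n))"
      by (simp add: truncated_moment_def)
    moreover have "of_real (cutoff (a n) (L n) (norm z) / norm z ^ k * f z) * sgn z powi - int k =
       of_real (cutoff (a n) (L n) (norm z) * f z) / z ^ k" if "z \<in> annulus (a n) (a n + L n)" for z
    proof -
      have z: "z \<noteq> 0" using that an by (auto simp: annulus_def)
      have "sgn z powi - int k = of_real (norm z ^ k) / z ^ k"
        using z by (simp add: power_int_minus sgn_eq power_divide)
      then show ?thesis using z by simp
    qed
    ultimately have "((\<lambda>z. of_real (cutoff (a n) (L n) (norm z) * f z) / z ^ k) has_integral
        truncated_moment (a n) (L n) k f) (annulus (a n) (a n + L n))"
      by (rule has_integral_eq[rotated])
    then show ?thesis
      unfolding g_def using sub by simp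
  qed
  have bound: "norm (g n z) \<le> \<bar>f z\<bar> * (1 / r0 ^ k)" if z: "z \<in> exterior r0" for n z
  proof (cases "z \<in> annulus (a n) (a n + L n)")
    case True
    then have "norm z \<in> {a n..a n + L n}" by (simp add: annulus_def)
    then have c: "0 \<le> cutoff (a n) (L n) (norm z)" "cutoff (a n) (L n) (norm z) \<le> 1"
      using cutoff_bounds(1,2)[OF L(1)] by auto
    have "r0 ^ k \<le> norm z ^ k"
      using z r0 by (intro power_mono) (auto simp: exterior_def)
    then have "(cutoff (a n) (L n) (norm z) * \<bar>f z\<bar>) / norm z ^ k \<le> (1 * \<bar>f z\<bar>) / r0 ^ k"
      using c r0 by (intro frac_le mult_right_mono) auto
    then show ?thesis
      using c True by (simp add: g_def norm_divide norm_mult norm_power)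
  next
    case False
    then show ?thesis using r0 by (simp add: g_def)
  qed
  have lim: "(\<lambda>n. g n z) \<longlonglongrightarrow> of_real (f z) / z ^ k" if z: "z \<in> exterior r0" for z
  proof -
    have "r0 < norm z" using z by (simp add: exterior_def)
    then have "\<forall>\<^sub>F n in sequentially. a n < norm z"
      using a(2) by (rule order_tendstoD(2)[rotated])
    moreover have "\<forall>\<^sub>F n in sequentially. norm z \<le> L n"
      using L(2) by (simp add: filterlim_at_top)
    ultimately have ev: "\<forall>\<^sub>F n in sequentially. of_real (cutoff (a n) (L n) (norm z) * f z) / z ^ k = g n z"
    proof eventually_elim
      case (elim n)
      then show ?case
        using a(1)[of n] r0 by (simp add: g_def annulus_def)
    qed
    have "z \<noteq> 0" using z r0 by (auto simp: exterior_def)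
    then have "(\<lambda>n. of_real (cutoff (a n) (L n) (norm z) * f z) / z ^ k) \<longlonglongrightarrow> of_real (1 * f z) / z ^ k"
      by (intro tendsto_intros cutoff_tendsto[OF a(2) L(2)]) auto
    then show ?thesis
      using tendsto_cong[OF ev] by simp
  qed
  have f1': "(\<lambda>z. \<bar>f z\<bar> * (1 / r0 ^ k)) integrable_on exterior r0"
    using f1 by (intro integrable_on_mult_left) (simp add: absolutely_integrable_on_def)
  have "(\<lambda>n. integral (exterior r0) (g n)) \<longlonglongrightarrow> integral (exterior r0) (\<lambda>z. of_real (f z) / z ^ k)"
    by (rule dominated_convergence(2)[OF _ f1' bound lim]) (use gn in blast)+
  then show ?thesis
    using integral_unique[OF gn] by simp
qed

section \<open>Oseen equation as a conservation law\<close>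

lemma inverse_power_has_vector_derivative:
  assumes "r \<noteq> (0::real)"
  shows "((\<lambda>r. of_real (1 / r ^ k) :: complex) has_vector_derivative of_real (- real k / (r * r ^ k))) (at r)"
proof -
  have "((\<lambda>r. r powi (- int k)) has_real_derivative (of_int (- int k) * r powi (- int k - 1) * 1)) (at r)"
    using assms by (intro DERIV_power_int DERIV_ident) auto
  moreover have "r powi (- int k - 1) = 1 / (r * r ^ k)"
    using assms by (simp add: power_int_diff power_int_minus field_simps)
  ultimately have "((\<lambda>r. 1 / r ^ k) has_real_derivative - real k / (r * r ^ k)) (at r)"
    by (simp add: power_int_minus field_simps)
  then show ?thesis by (rule has_vector_derivative_of_real)
qed

text \<open>
  A solution with names for its Fourier coefficients and their derivatives. The radial derivative is
  taken within $[r_0, \infty)$ in order to have a value on the circle.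
\<close>

locale oseen_solution =
  fixes r0 vx vy :: real
    and w0 :: "int \<Rightarrow> real \<Rightarrow> complex"
    and w :: "real \<Rightarrow> complex \<Rightarrow> real"
  assumes r0: "r0 > 0" and flow: "oseen_flow r0 vx vy w0 w"
begin

definition V :: complex where "V = Complex vx vy"

definition coeff :: "int \<Rightarrow> real \<Rightarrow> real \<Rightarrow> complex" where
  "coeff j t r = ang_coeff (w t) j r"

definition coeff_r :: "int \<Rightarrow> real \<Rightarrow> real \<Rightarrow> complex" where
  "coeff_r j t r = vector_derivative (ang_coeff (w t) j) (at r within {r0..})"

definition coeff_rr :: "int \<Rightarrow> real \<Rightarrow> real \<Rightarrow> complex" where
  "coeff_rr j t r = vector_derivative (\<lambda>\<rho>. vector_derivative (ang_coeff (w t) j) (at \<rho>)) (at r)"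

definition coeff_t :: "int \<Rightarrow> real \<Rightarrow> real \<Rightarrow> complex" where
  "coeff_t j t r = vector_derivative (\<lambda>s. ang_coeff (w s) j r) (at t)"

text \<open>
  The $k$-th coefficient of the product of the radial drift velocity with the solution.
\<close>

definition normal_wind :: "nat \<Rightarrow> real \<Rightarrow> real \<Rightarrow> complex" where
  "normal_wind k t r = v_rad vx vy 1 * coeff (int k - 1) t r + v_rad vx vy (- 1) * coeff (int k + 1) t r"

text \<open>
  This is $F_k = r^{1-k} (\partial_r w_k + \frac{k}{r} w_k - [v_r w]_k)$, the normal component of
  the vector field $z^{-k} \nabla w - w \nabla z^{-k} - z^{-k} w v$ integrated over the circle, up to
  the factor $2\pi$.
\<close>

definition flux :: "nat \<Rightarrow> real \<Rightarrow> real \<Rightarrow> complex" where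
  "flux k t r = of_real (1 / r ^ k) * (of_real r * coeff_r (int k) t r + of_nat k * coeff (int k) t r - of_real r * normal_wind k t r)"

lemmas regularity = flow[unfolded oseen_flow_def classical_regularity_def, THEN conjunct2, THEN conjunct1]

lemma w_L1: "0 \<le> t \<Longrightarrow> set_integrable lebesgue (exterior r0) (w t)"
  using flow by (simp add: oseen_flow_def L1_trajectory_def)

lemma w_continuous: "continuous_on ({0<..} \<times> {z. r0 \<le> norm z}) (\<lambda>(t, z). w t z)"
  using regularity by blast

lemma w_continuous_space: "0 < t \<Longrightarrow> continuous_on (exterior r0) (w t)"
  by (rule continuous_on_compose2[OF w_continuous, of _ "\<lambda>z. (t, z)", simplified])
    (auto simp: exterior_def intro!: continuous_intros)

text \<open>
  Joint continuity up to the circle is inherited from the solution itself, by integrating over the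
  compact circle.
\<close>

lemma coeff_continuous: "continuous_on ({0<..} \<times> {r0..}) (\<lambda>(t, r). coeff j t r)"
proof -
  have c: "continuous_on (({0<..} \<times> {r0..}) \<times> cbox 0 (2*pi))
     (\<lambda>(p, \<phi>). of_real (w (fst p) (rcis (snd p) \<phi>)) * cis (- (of_int j * \<phi>)))"
  proof -
    have "continuous_on (({0<..} \<times> {r0..}) \<times> cbox 0 (2*pi)) (\<lambda>x. (\<lambda>(t, z). w t z) (fst (fst x), rcis (snd (fst x)) (snd x)))"
      using r0 by (intro continuous_on_compose2[OF w_continuous])
        (auto simp: rcis_def norm_mult intro!: continuous_intros)
    then show ?thesis
      unfolding split_def by (intro continuous_intros) simp
  qed
  have "continuous_on ({0<..} \<times> {r0..}) (\<lambda>p. 1 / (2 * pi) * integral (cbox 0 (2*pi))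
     (\<lambda>\<phi>. of_real (w (fst p) (rcis (snd p) \<phi>)) * cis (- (of_int j * \<phi>))))"
    by (intro continuous_on_mult continuous_on_const integral_continuous_on_param c)
  moreover have "1 / (2 * pi) * integral (cbox 0 (2*pi))
     (\<lambda>\<phi>. of_real (w (fst p) (rcis (snd p) \<phi>)) * cis (- (of_int j * \<phi>))) = (\<lambda>(t, r). coeff j t r) p"
    if p: "p \<in> {0<..} \<times> {r0..}" for p
  proof -
    have "continuous_on {z. r0 \<le> norm z} (w (fst p))"
      using p by (intro continuous_on_compose2[OF w_continuous, of _ "\<lambda>z. (fst p, z)", simplified])
        (auto intro!: continuous_intros)
    moreover have "rcis (snd p) \<phi> \<in> {z. r0 \<le> norm z}" for \<phi>
      using p r0 by auto
    ultimately show ?thesis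
      using ang_coeff_eq_integral[of "{z. r0 \<le> norm z}" "w (fst p)" "snd p"] by (simp add: split_def coeff_def)
  qed
  ultimately show ?thesis
    by (rule continuous_on_eq)
qed

lemma radial_derivative_continuous: "continuous_on ({0<..} \<times> {r0..}) (\<lambda>(t, r). coeff_r j t r)"
  using regularity unfolding coeff_r_def by blast

lemma time_derivative_continuous: "continuous_on ({0<..} \<times> {r0<..}) (\<lambda>(t, r). coeff_t j t r)"
  using regularity unfolding coeff_t_def by blast

lemma has_time_derivative:
  assumes "0 < t" "r0 < r"
  shows "((\<lambda>s. coeff j s r) has_vector_derivative coeff_t j t r) (at t)"
  using regularity assms unfolding coeff_def coeff_t_def by (simp add: vector_derivative_works)

lemma radial_derivative_at:
  assumes "r0 < r"
  shows "coeff_r j t r = vector_derivative (ang_coeff (w t) j) (at r)"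
proof -
  have "at r within {r0..} = at r"
    using assms by (intro at_within_interior) (simp add: interior_Ici)
  then show ?thesis by (simp add: coeff_r_def)
qed

lemma has_radial_derivative:
  assumes "0 < t" "r0 < r"
  shows "(coeff j t has_vector_derivative coeff_r j t r) (at r)"
proof -
  have "at r within {r0..} = at r"
    using assms by (intro at_within_interior) (simp add: interior_Ici)
  moreover have "ang_coeff (w t) j differentiable (at r within {r0..})"
    using regularity assms by simp
  ultimately show ?thesis
    unfolding radial_derivative_at[OF assms(2)] coeff_def[abs_def] by (simp add: vector_derivative_works)
qed

lemma has_second_radial_derivative:
  assumes "0 < t" "r0 < r"
  shows "(coeff_r j t has_vector_derivative coeff_rr j t r) (at r)"
proof -
  have "(\<lambda>\<rho>. vector_derivative (ang_coeff (w t) j) (at \<rho>)) differentiable (at r)"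
    using regularity assms by simp
  then have "((\<lambda>\<rho>. vector_derivative (ang_coeff (w t) j) (at \<rho>)) has_vector_derivative coeff_rr j t r) (at r)"
    unfolding coeff_rr_def by (simp add: vector_derivative_works)
  then show ?thesis
    by (rule has_vector_derivative_transform_within_open[of _ _ _ "{r0<..}"])
      (use assms in \<open>auto simp: radial_derivative_at\<close>)
qed

lemma oseen_equation:
  assumes "0 < t" "r0 < r"
  shows "coeff_t k t r = coeff_rr k t r + coeff_r k t r / r - of_int (k\<^sup>2) / (of_real r)\<^sup>2 * coeff k t r
    - (v_rad vx vy 1 * (coeff_r (k - 1) t r - of_int (k - 1) / of_real r * coeff (k - 1) t r)
       + v_rad vx vy (- 1) * (coeff_r (k + 1) t r + of_int (k + 1) / of_real r * coeff (k + 1) t r))"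
proof -
  have rg: "\<And>z. z \<in> exterior r0 \<Longrightarrow> w t differentiable (at z)"
    "continuous_on ({0<..} \<times> exterior r0) (\<lambda>(t, z). partial_x1 (w t) z)"
    "continuous_on ({0<..} \<times> exterior r0) (\<lambda>(t, z). partial_x2 (w t) z)"
    using regularity assms(1) by blast+
  have slice: "continuous_on (exterior r0) (g t)"
    if "continuous_on ({0<..} \<times> exterior r0) (\<lambda>(t, z). g t z)" for g :: "real \<Rightarrow> complex \<Rightarrow> real"
    using assms(1) by (intro continuous_on_compose2[OF that, of _ "\<lambda>z. (t, z)", simplified])
      (auto intro!: continuous_intros)
  have drift: "ang_coeff (drift vx vy (w t)) k r =
     v_rad vx vy 1 * (coeff_r (k - 1) t r - of_int (k - 1) / of_real r * coeff (k - 1) t r)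
       + v_rad vx vy (- 1) * (coeff_r (k + 1) t r + of_int (k + 1) / of_real r * coeff (k + 1) t r)"
    unfolding radial_derivative_at[OF assms(2)] coeff_def
    by (rule ang_coeff_drift[OF r0 rg(1) slice[OF rg(2)] slice[OF rg(3)] assms(2)])
  have "((\<lambda>\<rho>. of_real \<rho> * vector_derivative (ang_coeff (w t) k) (at \<rho>)) has_vector_derivative
      of_real r * coeff_rr k t r + of_real 1 * coeff_r k t r) (at r)"
  proof -
    have "((\<lambda>\<rho>. of_real \<rho> * coeff_r k t \<rho>) has_vector_derivative
      of_real r * coeff_rr k t r + of_real 1 * coeff_r k t r) (at r)"
      by (intro has_vector_derivative_mult has_second_radial_derivative assms has_vector_derivative_of_real DERIV_ident)
    then show ?thesis
      by (rule has_vector_derivative_transform_within_open[of _ _ _ "{r0<..}"])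
        (use assms in \<open>auto simp: radial_derivative_at\<close>)
  qed
  then have Delta: "Delta_k k (ang_coeff (w t) k) r =
      coeff_rr k t r + coeff_r k t r / r - of_int (k\<^sup>2) / (of_real r)\<^sup>2 * coeff k t r"
    using assms r0 unfolding Delta_k_def by (simp add: vector_derivative_at coeff_def field_simps)
  have "coeff_t k t r - Delta_k k (ang_coeff (w t) k) r + ang_coeff (drift vx vy (w t)) k r = 0"
    using flow assms by (simp add: oseen_flow_def oseen_system_def coeff_t_def)
  then show ?thesis
    unfolding Delta drift by (simp add: algebra_simps)
qed

text \<open>
  Up to the factor $r_0^{-k}$ the flux at the circle is the difference of the two sides of the
  boundary condition, because $|k| = k$ for the orders considered.
\<close>

lemma flux_boundary:
  assumes "0 < t"
  shows "flux k t r0 = 0"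
proof -
  have "of_real r0 * coeff_r (int k) t r0 + of_int \<bar>int k\<bar> * coeff (int k) t r0 = of_real r0 * normal_wind k t r0"
    using flow assms unfolding oseen_flow_def oseen_system_def coeff_r_def coeff_def normal_wind_def by blast
  then show ?thesis by (simp add: flux_def)
qed

lemma flux_continuous: "continuous_on ({0<..} \<times> {r0..}) (\<lambda>(t, r). flux k t r)"
  using coeff_continuous radial_derivative_continuous r0
  unfolding flux_def normal_wind_def split_def by (intro continuous_intros) auto

text \<open>
  The Laplace term of the equation becomes $\partial_r (r^{1-k} \partial_r w_k + k r^{-k} w_k)$, since
  $r^{-k}$ solves the radial Laplace equation. Of the drift, the part with $w_{k-1}$ is
  $\partial_r (r^{1-k} w_{k-1})$ and the part with $w_{k+1}$ is
  $\partial_r (r^{1-k} w_{k+1}) + 2 k r^{-k} w_{k+1}$; with the weight $V / 2$ the last summand is the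
  coupling to the next moment.
\<close>

lemma flux_has_vector_derivative:
  assumes t: "0 < t" and r: "r0 < r"
  shows "(flux k t has_vector_derivative
     of_real (1 / r ^ k) * (of_real r * coeff_t (int k) t r + of_nat k * V * coeff (int k + 1) t r)) (at r)"
proof -
  have rpos: "r \<noteq> 0" using r r0 by simp
  let ?K = "int k"
  let ?A' = "v_rad vx vy 1 * coeff_r (?K - 1) t r + v_rad vx vy (- 1) * coeff_r (?K + 1) t r"
  let ?q = "of_real (1 / r ^ k) :: complex"
  have normal_wind: "(normal_wind k t has_vector_derivative ?A') (at r)"
    unfolding normal_wind_def[abs_def]
    by (intro has_vector_derivative_add has_vector_derivative_mult_right has_radial_derivative t r)
  have ru': "((\<lambda>r. of_real r * coeff_r ?K t r) has_vector_derivative of_real r * coeff_rr ?K t r + of_real 1 * coeff_r ?K t r) (at r)"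
    by (intro has_vector_derivative_mult has_second_radial_derivative t r has_vector_derivative_of_real DERIV_ident)
  have rbd: "((\<lambda>r. of_real r * normal_wind k t r) has_vector_derivative of_real r * ?A' + of_real 1 * normal_wind k t r) (at r)"
    by (intro has_vector_derivative_mult normal_wind has_vector_derivative_of_real DERIV_ident)
  have "(flux k t has_vector_derivative ?q *
       (of_real r * coeff_rr ?K t r + of_real 1 * coeff_r ?K t r + of_nat k * coeff_r ?K t r - (of_real r * ?A' + of_real 1 * normal_wind k t r))
      + of_real (- real k / (r * r ^ k)) * (of_real r * coeff_r ?K t r + of_nat k * coeff ?K t r - of_real r * normal_wind k t r)) (at r)"
    unfolding flux_def[abs_def]
    by (intro has_vector_derivative_mult has_vector_derivative_diff has_vector_derivative_add ru' rbd
        has_vector_derivative_mult_right has_radial_derivative t r inverse_power_has_vector_derivative rpos)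
  moreover have "of_real (- real k / (r * r ^ k)) = - ?q * of_nat k / of_real r"
    by simp
  moreover have "?q * (of_real r * coeff_rr ?K t r + of_real 1 * coeff_r ?K t r + of_nat k * coeff_r ?K t r - (of_real r * ?A' + of_real 1 * normal_wind k t r))
      + (- ?q * of_nat k / of_real r) * (of_real r * coeff_r ?K t r + of_nat k * coeff ?K t r - of_real r * normal_wind k t r)
    = ?q * (of_real r * coeff_t (int k) t r + of_nat k * V * coeff (int k + 1) t r)"
  proof -
    have vV: "v_rad vx vy (- 1) = V / 2"
      by (simp add: v_rad_def V_def complex_eq_iff)
    have normal_wind': "normal_wind k t r = v_rad vx vy 1 * coeff (?K - 1) t r + V / 2 * coeff (?K + 1) t r"
      by (simp add: normal_wind_def vV)
    have cr: "complex_of_real r \<noteq> 0" using rpos by simp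
    have gen: "q * (R * c + of_real 1 * b + K * b - (R * (v * x + V / 2 * y) + of_real 1 * (v * p + V / 2 * s)))
       + (- q * K / R) * (R * b + K * a - R * (v * p + V / 2 * s))
      = q * (R * (c + b / R - K\<^sup>2 / R\<^sup>2 * a - (v * (x - (K - 1) / R * p) + V / 2 * (y + (K + 1) / R * s))) + K * V * s)"
      if "R \<noteq> 0" for q R K a b c v x y p s V :: complex
      using that by (simp add: field_simps power2_eq_square)
    show ?thesis
      unfolding oseen_equation[OF t r] vV normal_wind'
      using gen[OF cr, of ?q "coeff_rr ?K t r" "coeff_r ?K t r" "of_nat k" "v_rad vx vy 1" "coeff_r (?K - 1) t r" V "coeff_r (?K + 1) t r" "coeff (?K - 1) t r" "coeff (?K + 1) t r" "coeff ?K t r"]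
      by simp
  qed
  ultimately show ?thesis by (simp only:)
qed

text \<open>
  This is $-\int F_k \chi'\, dr$ after the radial derivative in $F_k$ has been moved onto the
  derivative of the cutoff $\chi$.
\<close>

definition cutoff_error :: "real \<Rightarrow> real \<Rightarrow> nat \<Rightarrow> real \<Rightarrow> complex" where
  "cutoff_error a L k t =
     integral {a..a + L} (\<lambda>r. of_real (r * (cutoff'' a L r / r ^ k + (1 - 2 * real k) * cutoff' a L r / (r * r ^ k))) * coeff (int k) t r)
     + v_rad vx vy 1 * integral {a..a + L} (\<lambda>r. of_real (r * (cutoff' a L r / r ^ k)) * coeff (int k - 1) t r)
     + v_rad vx vy (- 1) * integral {a..a + L} (\<lambda>r. of_real (r * (cutoff' a L r / r ^ k)) * coeff (int k + 1) t r)"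

lemma slice_continuous:
  assumes "continuous_on ({0<..} \<times> S) (\<lambda>(t, r). g t r)" "0 < t" "T \<subseteq> S"
  shows "continuous_on T (g t)"
  using assms(2,3) by (intro continuous_on_compose2[OF assms(1), of _ "\<lambda>r. (t, r)", simplified])
    (auto intro!: continuous_intros)

text \<open>
  The subtracted product $\chi' r^{1-k} w_k$ performs the second integration by parts: its derivative
  removes $\chi' r^{1-k} \partial_r w_k$, the only term of $\chi' F_k$ that contains a derivative of
  the solution.
\<close>

lemma cutoff_flux_has_vector_derivative:
  assumes t: "0 < t" and r: "r0 < r" and L: "0 < L"
  shows "((\<lambda>r. of_real (cutoff a L r) * flux k t r - of_real (cutoff' a L r) * (of_real (1 / r ^ k) * (of_real r * coeff (int k) t r)))
     has_vector_derivative
       of_real (r * (cutoff a L r / r ^ k)) * coeff_t (int k) t r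
       + of_nat k * V * (of_real (r * (cutoff a L r / r ^ Suc k)) * coeff (int (Suc k)) t r)
       - (of_real (r * (cutoff'' a L r / r ^ k + (1 - 2 * real k) * cutoff' a L r / (r * r ^ k))) * coeff (int k) t r
          + v_rad vx vy 1 * (of_real (r * (cutoff' a L r / r ^ k)) * coeff (int k - 1) t r)
          + v_rad vx vy (- 1) * (of_real (r * (cutoff' a L r / r ^ k)) * coeff (int k + 1) t r))) (at r)"
proof -
  have rpos: "r \<noteq> 0" using r r0 by simp
  have ru: "((\<lambda>r. of_real r * coeff (int k) t r) has_vector_derivative of_real r * coeff_r (int k) t r + of_real 1 * coeff (int k) t r) (at r)"
    by (intro has_vector_derivative_mult has_radial_derivative t r has_vector_derivative_of_real DERIV_ident)
  have gen: "(c * (q * (R * U + K * V * s)) + c' * (q * (R * b + K * a - R * (v * p + v2 * s))))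
      - (c' * (q * (R * b + of_real 1 * a) + (- K * q / R) * (R * a)) + c'' * (q * (R * a)))
     = R * (c * q) * U + K * V * (R * (c * (q / R)) * s)
       - (R * (c'' * q + (1 - 2 * K) * c' * q / R) * a + v * (R * (c' * q) * p) + v2 * (R * (c' * q) * s))"
    if "R \<noteq> 0" for c c' c'' q R U K V s a b v p v2 :: complex
    using that by (simp add: field_simps)
  have cr: "complex_of_real r \<noteq> 0" using rpos by simp
  have "((\<lambda>r. of_real (cutoff a L r) * flux k t r - of_real (cutoff' a L r) * (of_real (1 / r ^ k) * (of_real r * coeff (int k) t r)))
     has_vector_derivative
      (of_real (cutoff a L r) * (of_real (1 / r ^ k) * (of_real r * coeff_t (int k) t r + of_nat k * V * coeff (int k + 1) t r))
        + of_real (cutoff' a L r) * flux k t r)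
      - (of_real (cutoff' a L r) * (of_real (1 / r ^ k) * (of_real r * coeff_r (int k) t r + of_real 1 * coeff (int k) t r)
            + of_real (- real k / (r * r ^ k)) * (of_real r * coeff (int k) t r))
         + of_real (cutoff'' a L r) * (of_real (1 / r ^ k) * (of_real r * coeff (int k) t r)))) (at r)"
    by (intro has_vector_derivative_mult has_vector_derivative_diff ru flux_has_vector_derivative t r
        has_vector_derivative_of_real cutoff_deriv L inverse_power_has_vector_derivative rpos)
  then show ?thesis
  proof (rule has_vector_derivative_eq_rhs)
    let ?q = "of_real (1 / r ^ k) :: complex"
    have conv: "complex_of_real (r * (x / r ^ k)) = of_real r * (of_real x * ?q)"
      "complex_of_real (r * (x / r ^ Suc k)) = of_real r * (of_real x * (?q / of_real r))"
      "complex_of_real (r * (x / r ^ k + (1 - 2 * real k) * y / (r * r ^ k)))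
        = of_real r * (of_real x * ?q + (1 - 2 * of_nat k) * of_real y * ?q / of_real r)"
      "complex_of_real (- real k / (r * r ^ k)) = - of_nat k * ?q / of_real r"
      "int (Suc k) = int k + 1" for x y
      by simp_all
    show "of_real (cutoff a L r) * (of_real (1 / r ^ k) * (of_real r * coeff_t (int k) t r + of_nat k * V * coeff (int k + 1) t r))
        + of_real (cutoff' a L r) * flux k t r
      - (of_real (cutoff' a L r) * (of_real (1 / r ^ k) * (of_real r * coeff_r (int k) t r + of_real 1 * coeff (int k) t r)
            + of_real (- real k / (r * r ^ k)) * (of_real r * coeff (int k) t r))
         + of_real (cutoff'' a L r) * (of_real (1 / r ^ k) * (of_real r * coeff (int k) t r)))
      = of_real (r * (cutoff a L r / r ^ k)) * coeff_t (int k) t r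
       + of_nat k * V * (of_real (r * (cutoff a L r / r ^ Suc k)) * coeff (int (Suc k)) t r)
       - (of_real (r * (cutoff'' a L r / r ^ k + (1 - 2 * real k) * cutoff' a L r / (r * r ^ k))) * coeff (int k) t r
          + v_rad vx vy 1 * (of_real (r * (cutoff' a L r / r ^ k)) * coeff (int k - 1) t r)
          + v_rad vx vy (- 1) * (of_real (r * (cutoff' a L r / r ^ k)) * coeff (int k + 1) t r))"
      unfolding conv flux_def normal_wind_def by (rule gen[OF cr])
  qed
qed

text \<open>
  Differentiation under the integral sign is possible because the time derivative is continuous on
  the compact interval $[a, a + L]$, which avoids the circle. The conservation law and the
  fundamental theorem of calculus then evaluate the integral.
\<close>

lemma truncated_moment_has_vector_derivative:
  assumes t: "0 < t" and a: "r0 < a" and L: "0 < L"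
  shows "((\<lambda>s. truncated_moment a L k (w s)) has_vector_derivative
     - of_nat k * V * truncated_moment a L (Suc k) (w t)
     + 2 * pi * (cutoff_error a L k t - flux k t a)) (at t)"
proof -
  let ?f = "\<lambda>t r. of_real (r * (cutoff a L r / r ^ k)) * coeff (int k) t r"
  let ?ft = "\<lambda>t r. of_real (r * (cutoff a L r / r ^ k)) * coeff_t (int k) t r"
  have pos: "r \<noteq> 0" "r0 < r" if "r \<in> {a..a + L}" for r
    using that a r0 by auto
  have sub: "{a..a + L} \<subseteq> {r0..}" "{a..a + L} \<subseteq> {r0<..}"
    using a by auto
  have c0: "continuous_on {a..a + L} (\<lambda>r. of_real (r * (cutoff a L r / r ^ m)) :: complex)"
      "continuous_on {a..a + L} (\<lambda>r. of_real (r * (cutoff' a L r / r ^ m)) :: complex)"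
      "continuous_on {a..a + L} (\<lambda>r. of_real (r * (cutoff'' a L r / r ^ k + (1 - 2 * real k) * cutoff' a L r / (r * r ^ k))) :: complex)" for m
    using pos L by (intro continuous_intros; auto)+
  have cu: "continuous_on {a..a + L} (coeff j t)" for j
    by (rule slice_continuous[OF coeff_continuous t sub(1)])
  have int: "((\<lambda>r. c r * coeff j t r) has_integral integral {a..a + L} (\<lambda>r. c r * coeff j t r)) {a..a + L}"
    if "continuous_on {a..a + L} c" for c j
    by (intro integrable_integral integrable_continuous_real continuous_on_mult that cu)
  have "((\<lambda>t. integral (cbox a (a + L)) (?f t)) has_vector_derivative integral (cbox a (a + L)) (?ft t)) (at t within {0<..})"
  proof (rule leibniz_rule_vector_derivative)
    fix s r :: real assume "s \<in> {0<..}" "r \<in> cbox a (a + L)"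
    then show "((\<lambda>s. ?f s r) has_vector_derivative ?ft s r) (at s within {0<..})"
      using pos by (intro has_vector_derivative_at_within[OF has_vector_derivative_mult_right] has_time_derivative) auto
  next
    fix s :: real assume s: "s \<in> {0<..}"
    then show "?f s integrable_on cbox a (a + L)"
      unfolding box_real using slice_continuous[OF coeff_continuous _ sub(1)]
      by (intro integrable_continuous_real continuous_on_mult c0) auto
  next
    have "continuous_on ({0<..} \<times> {a..a + L}) (\<lambda>(t, r). coeff_t (int k) t r)"
      using sub by (intro continuous_on_subset[OF time_derivative_continuous]) auto
    moreover have "continuous_on ({0<..} \<times> {a..a + L}) (\<lambda>p. of_real (snd p * (cutoff a L (snd p) / snd p ^ k)) :: complex)"
      by (intro continuous_on_compose2[OF c0(1)[of k]] continuous_intros) auto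
    ultimately show "continuous_on ({0<..} \<times> cbox a (a + L)) (\<lambda>(t, r). ?ft t r)"
      unfolding split_def box_real by (intro continuous_on_mult)
  qed (use t in auto)
  then have D: "((\<lambda>s. truncated_moment a L k (w s)) has_vector_derivative 2 * pi * integral {a..a + L} (?ft t)) (at t)"
    unfolding truncated_moment_def coeff_def[symmetric]
    using t by (intro has_vector_derivative_mult_right) (simp add: at_within_open[of t "{0<..}"])
  let ?G = "\<lambda>r. of_real (cutoff a L r) * flux k t r - of_real (cutoff' a L r) * (of_real (1 / r ^ k) * (of_real r * coeff (int k) t r))"
  let ?N = "\<lambda>r. of_real (r * (cutoff a L r / r ^ Suc k)) * coeff (int (Suc k)) t r"
  let ?e0 = "\<lambda>r. of_real (r * (cutoff'' a L r / r ^ k + (1 - 2 * real k) * cutoff' a L r / (r * r ^ k))) * coeff (int k) t r"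
  let ?e1 = "\<lambda>j r. of_real (r * (cutoff' a L r / r ^ k)) * coeff j t r"
  let ?e = "\<lambda>r. ?e0 r + v_rad vx vy 1 * ?e1 (int k - 1) r + v_rad vx vy (- 1) * ?e1 (int k + 1) r"
  have "((\<lambda>r. ?ft t r + of_nat k * V * ?N r - ?e r) has_integral ?G (a + L) - ?G a) {a..a + L}"
  proof (rule fundamental_theorem_of_calculus)
    fix r assume "r \<in> {a..a + L}"
    then show "(?G has_vector_derivative ?ft t r + of_nat k * V * ?N r - ?e r) (at r within {a..a + L})"
      by (rule has_vector_derivative_at_within[OF cutoff_flux_has_vector_derivative[OF t pos(2) L]])
  qed (use L in simp)
  moreover have "?G (a + L) - ?G a = - flux k t a"
    unfolding cutoff_ends[OF L] by simp
  ultimately have G: "((\<lambda>r. ?ft t r + of_nat k * V * ?N r - ?e r) has_integral - flux k t a) {a..a + L}"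
    by (rule subst[rotated])
  have J: "(?N has_integral integral {a..a + L} ?N) {a..a + L}"
    by (rule int[OF c0(1)])
  have E: "(?e has_integral cutoff_error a L k t) {a..a + L}"
    unfolding cutoff_error_def
    by (rule has_integral_add[OF has_integral_add[OF int[OF c0(3)] has_integral_mult_right[OF int[OF c0(2)]]]
        has_integral_mult_right[OF int[OF c0(2)]]])
  have "((\<lambda>r. (?ft t r + of_nat k * V * ?N r - ?e r) + ?e r - of_nat k * V * ?N r) has_integral
      - flux k t a + cutoff_error a L k t - of_nat k * V * integral {a..a + L} ?N) {a..a + L}"
    by (rule has_integral_diff[OF has_integral_add[OF G E] has_integral_mult_right[OF J]])
  then have "(?ft t has_integral - flux k t a + cutoff_error a L k t - of_nat k * V * integral {a..a + L} ?N) {a..a + L}"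
    by (rule has_integral_eq[rotated]) (simp only: diff_add_cancel add_diff_cancel_right')
  then have ft: "integral {a..a + L} (?ft t) = - flux k t a + cutoff_error a L k t - of_nat k * V * integral {a..a + L} ?N"
    by (rule integral_unique)
  have tm: "truncated_moment a L (Suc k) (w t) = 2 * pi * integral {a..a + L} ?N"
    by (simp only: truncated_moment_def coeff_def)
  have "c * (- f + e - K * V * J) = - K * V * (c * J) + c * (e - f)" for c f e K V J :: complex
    by (simp add: algebra_simps)
  then show ?thesis
    by (intro has_vector_derivative_eq_rhs[OF D]) (simp only: ft tm)
qed

definition mass :: "real \<Rightarrow> real" where
  "mass t = integral (exterior r0) (\<lambda>z. \<bar>w t z\<bar>)"

definition error_const :: "nat \<Rightarrow> real" where
  "error_const k = (12 + \<bar>1 - 2 * real k\<bar> * 4 / r0) / r0 ^ k + norm (v_rad vx vy 1) * (4 / r0 ^ k)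
     + norm (v_rad vx vy (- 1)) * (4 / r0 ^ k)"

text \<open>
  Every weight in the error carries a derivative of the cutoff and hence a factor $1/L$, while the
  powers of $r$ are bounded because $r \ge r_0$.
\<close>

lemma cutoff_error_bound:
  assumes t: "0 < t" and a: "r0 < a" and L: "1 \<le> L"
  shows "2 * pi * norm (cutoff_error a L k t) \<le> error_const k * mass t / L"
proof -
  have wA: "continuous_on (annulus a (a + L)) (w t)"
    by (rule continuous_on_subset[OF w_continuous_space[OF t]]) (use a in \<open>auto simp: annulus_def exterior_def\<close>)
  have B: "2 * pi * norm (integral {a..a + L} (\<lambda>r. of_real (r * c r) * coeff j t r)) \<le> B * mass t"
    if "continuous_on {a..a + L} c" "\<And>r. r \<in> {a..a + L} \<Longrightarrow> \<bar>c r\<bar> \<le> B" "0 \<le> B" for c B j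
    unfolding coeff_def mass_def using t by (intro annulus_ang_coeff_bound[OF r0 a wA that(1) w_L1 that(2,3)]) auto
  have pos: "r \<noteq> 0" "r0 \<le> r" "r0 ^ k \<le> r ^ k" "0 < r ^ k" if "r \<in> {a..a + L}" for r
    using that a r0 by (auto intro!: power_mono)
  have L0: "0 < L" using L by simp
  have b1: "\<bar>cutoff' a L r / r ^ k\<bar> \<le> 4 / L / r0 ^ k" if r: "r \<in> {a..a + L}" for r
    using cutoff_bounds(3)[OF L r] pos[OF r] r0 L0 unfolding abs_divide by (intro frac_le) auto
  have b2: "\<bar>cutoff'' a L r / r ^ k + (1 - 2 * real k) * cutoff' a L r / (r * r ^ k)\<bar>
      \<le> 12 / L / r0 ^ k + \<bar>1 - 2 * real k\<bar> * (4 / L) / (r0 * r0 ^ k)" if r: "r \<in> {a..a + L}" for r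
  proof -
    have "\<bar>cutoff'' a L r / r ^ k\<bar> \<le> 12 / L / r0 ^ k"
      using cutoff_bounds(4)[OF L r] pos[OF r] r0 L0 unfolding abs_divide by (intro frac_le) auto
    moreover have "\<bar>(1 - 2 * real k) * cutoff' a L r / (r * r ^ k)\<bar> \<le> \<bar>1 - 2 * real k\<bar> * (4 / L) / (r0 * r0 ^ k)"
      unfolding abs_divide abs_mult
      using cutoff_bounds(3)[OF L r] pos[OF r] r0 L0 by (intro frac_le mult_left_mono mult_nonneg_nonneg) (auto intro!: mult_mono)
    ultimately show ?thesis by linarith
  qed
  have c: "continuous_on {a..a + L} (\<lambda>r. cutoff'' a L r / r ^ k + (1 - 2 * real k) * cutoff' a L r / (r * r ^ k))"
    "continuous_on {a..a + L} (\<lambda>r. cutoff' a L r / r ^ k)"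
    using pos L0 by (intro continuous_intros; auto)+
  let ?e0 = "integral {a..a + L} (\<lambda>r. of_real (r * (cutoff'' a L r / r ^ k + (1 - 2 * real k) * cutoff' a L r / (r * r ^ k))) * coeff (int k) t r)"
  let ?e1 = "\<lambda>j. integral {a..a + L} (\<lambda>r. of_real (r * (cutoff' a L r / r ^ k)) * coeff j t r)"
  have e0: "2 * pi * norm ?e0 \<le> (12 / L / r0 ^ k + \<bar>1 - 2 * real k\<bar> * (4 / L) / (r0 * r0 ^ k)) * mass t"
    using r0 L0 by (intro B c b2) auto
  have e1: "2 * pi * norm (?e1 j) \<le> 4 / L / r0 ^ k * mass t" for j
    using r0 L0 by (intro B c b1) auto
  have "2 * pi * norm (cutoff_error a L k t) \<le> 2 * pi * (norm ?e0 + norm (v_rad vx vy 1) * norm (?e1 (int k - 1))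
      + norm (v_rad vx vy (- 1)) * norm (?e1 (int k + 1)))"
    unfolding cutoff_error_def norm_mult[symmetric] by (intro mult_left_mono norm_triangle_le add_mono order_refl) auto
  also have "\<dots> = 2 * pi * norm ?e0 + norm (v_rad vx vy 1) * (2 * pi * norm (?e1 (int k - 1)))
      + norm (v_rad vx vy (- 1)) * (2 * pi * norm (?e1 (int k + 1)))"
    by (simp add: algebra_simps)
  also have "\<dots> \<le> (12 / L / r0 ^ k + \<bar>1 - 2 * real k\<bar> * (4 / L) / (r0 * r0 ^ k)) * mass t
      + norm (v_rad vx vy 1) * (4 / L / r0 ^ k * mass t) + norm (v_rad vx vy (- 1)) * (4 / L / r0 ^ k * mass t)"
    by (intro add_mono mult_left_mono e0 e1) auto
  also have "\<dots> = error_const k * mass t / L"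
    using r0 L0 by (simp add: error_const_def field_simps)
  finally show ?thesis .
qed

section \<open>Evolution of the moments\<close>

definition moment :: "nat \<Rightarrow> real \<Rightarrow> complex" where
  "moment k t = integral (exterior r0) (\<lambda>z. of_real (w t z) / z ^ k)"

lemma L1_distance:
  assumes "0 \<le> t" "0 \<le> s"
  shows "set_integrable lebesgue (exterior r0) (\<lambda>z. w s z - w t z)"
    and "(LINT z:exterior r0|lebesgue. \<bar>w s z - w t z\<bar>) = integral (exterior r0) (\<lambda>z. \<bar>w s z - w t z\<bar>)"
proof -
  show d: "set_integrable lebesgue (exterior r0) (\<lambda>z. w s z - w t z)"
    using w_L1 assms by (intro set_integral_diff)
  show "(LINT z:exterior r0|lebesgue. \<bar>w s z - w t z\<bar>) = integral (exterior r0) (\<lambda>z. \<bar>w s z - w t z\<bar>)"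
    by (intro set_lebesgue_integral_eq_integral set_integrable_abs d)
qed

text \<open>
  Functionals of the trajectory that are Lipschitz for the $L_1$ distance are continuous in time,
  including at the initial time.
\<close>

lemma L1_continuous_functional:
  fixes \<Phi> :: "real \<Rightarrow> 'a::real_normed_vector"
  assumes "\<And>s t. 0 \<le> s \<Longrightarrow> 0 \<le> t \<Longrightarrow> norm (\<Phi> s - \<Phi> t) \<le> C * integral (exterior r0) (\<lambda>z. \<bar>w s z - w t z\<bar>)"
  shows "continuous_on {0..} \<Phi>"
  unfolding continuous_on_def
proof
  fix t :: real assume t: "t \<in> {0..}"
  let ?d = "\<lambda>s. LINT z:exterior r0|lebesgue. \<bar>w s z - w t z\<bar>"
  have "(?d \<longlongrightarrow> 0) (at t within {0..})"
    using flow t by (simp add: oseen_flow_def L1_trajectory_def)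
  then have "((\<lambda>s. C * ?d s) \<longlongrightarrow> C * 0) (at t within {0..})"
    by (intro tendsto_mult tendsto_const)
  then have lim: "((\<lambda>s. C * ?d s) \<longlongrightarrow> 0) (at t within {0..})"
    by simp
  have "norm (\<Phi> s - \<Phi> t) \<le> C * ?d s" if "s \<in> {0..}" for s
    unfolding L1_distance(2)[OF t[unfolded atLeast_iff] that[unfolded atLeast_iff]]
    using assms t that by blast
  then have "\<forall>\<^sub>F s in at t within {0..}. norm (\<Phi> s - \<Phi> t) \<le> C * ?d s"
    unfolding eventually_at_filter by (intro always_eventually) blast
  then have "((\<lambda>s. \<Phi> s - \<Phi> t) \<longlongrightarrow> 0) (at t within {0..})"
    by (rule Lim_null_comparison) (rule lim)
  then show "(\<Phi> \<longlongrightarrow> \<Phi> t) (at t within {0..})"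
    by (rule LIM_zero_cancel)
qed

lemma mass_continuous: "continuous_on {0..} mass"
proof (rule L1_continuous_functional[where C = 1])
  fix s t :: real assume st: "0 \<le> s" "0 \<le> t"
  have i: "(\<lambda>z. \<bar>w s z\<bar>) integrable_on exterior r0" "(\<lambda>z. \<bar>w t z\<bar>) integrable_on exterior r0"
     "(\<lambda>z. \<bar>w s z - w t z\<bar>) integrable_on exterior r0"
    using w_L1[OF st(1)] w_L1[OF st(2)] L1_distance(1)[OF st(2,1)] by (simp_all add: absolutely_integrable_on_def)
  have "mass s - mass t = integral (exterior r0) (\<lambda>z. \<bar>w s z\<bar> - \<bar>w t z\<bar>)"
    unfolding mass_def using i by (simp add: integral_diff)
  also have "norm \<dots> \<le> integral (exterior r0) (\<lambda>z. \<bar>w s z - w t z\<bar>)"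
    by (rule integral_norm_bound_integral) (use i in \<open>auto intro!: integrable_diff abs_triangle_ineq3\<close>)
  finally show "norm (mass s - mass t) \<le> 1 * integral (exterior r0) (\<lambda>z. \<bar>w s z - w t z\<bar>)"
    by simp
qed

lemma mass_bounded:
  obtains C where "0 \<le> C" "\<And>t. t \<in> {0..T} \<Longrightarrow> mass t \<le> C"
proof -
  have "compact (mass ` {0..T})"
    by (intro compact_continuous_image continuous_on_subset[OF mass_continuous]) auto
  then obtain C where C: "\<forall>x\<in>mass ` {0..T}. norm x \<le> C"
    using compact_imp_bounded bounded_iff by blast
  show thesis
  proof (rule that)
    show "0 \<le> max C 0" by simp
    show "mass t \<le> max C 0" if "t \<in> {0..T}" for t
      using C that by (force simp: abs_le_iff)
  qed
qed

lemma moment_bound: "0 \<le> t \<Longrightarrow> norm (moment k t) \<le> mass t / r0 ^ k"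
  unfolding moment_def mass_def by (intro exterior_moment_bound r0 w_L1)

lemma moment_continuous: "continuous_on {0..} (moment k)"
proof (rule L1_continuous_functional[where C = "1 / r0 ^ k"])
  fix s t :: real assume st: "0 \<le> s" "0 \<le> t"
  have i: "(\<lambda>z. of_real (w s z) / z ^ k) integrable_on exterior r0" "(\<lambda>z. of_real (w t z) / z ^ k) integrable_on exterior r0"
    using exterior_moment_integrable[OF r0 w_L1] st by (auto intro: set_lebesgue_integral_eq_integral(1))
  have "moment k s - moment k t = integral (exterior r0) (\<lambda>z. of_real (w s z - w t z) / z ^ k)"
    unfolding moment_def integral_diff[OF i, symmetric] by (simp add: diff_divide_distrib)
  then show "norm (moment k s - moment k t) \<le> 1 / r0 ^ k * integral (exterior r0) (\<lambda>z. \<bar>w s z - w t z\<bar>)"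
    using exterior_moment_bound[OF r0 L1_distance(1)[OF st(2,1)], of k] by simp
qed

lemma flux_bounded:
  assumes "0 < s"
  obtains F where "\<And>\<tau> r. \<tau> \<in> {s..t} \<Longrightarrow> r \<in> {r0..r0 + 1} \<Longrightarrow> norm (flux k \<tau> r) \<le> F"
proof -
  have "continuous_on ({s..t} \<times> {r0..r0 + 1}) (\<lambda>(\<tau>, r). flux k \<tau> r)"
    by (rule continuous_on_subset[OF flux_continuous]) (use assms in auto)
  then have "bounded ((\<lambda>(\<tau>, r). flux k \<tau> r) ` ({s..t} \<times> {r0..r0 + 1}))"
    by (intro compact_imp_bounded compact_continuous_image compact_Times compact_Icc)
  then obtain F where F: "\<And>x. x \<in> (\<lambda>(\<tau>, r). flux k \<tau> r) ` ({s..t} \<times> {r0..r0 + 1}) \<Longrightarrow> norm x \<le> F"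
    unfolding bounded_iff by blast
  show thesis
    by (rule that[of F], rule F) blast
qed

text \<open>
  The limit of the truncated equation, integrated over $[s, t]$, along $a_n = r_0 + 1/(n+1)$ and
  $L_n = n + 1$. The flux at $a_n$ tends to its boundary value zero for each time, and is bounded
  uniformly because it is continuous up to the circle; the error is bounded by the $L_1$ norm, and so
  are the truncated moments. Dominated convergence in time applies.
\<close>

lemma moment_increment:
  assumes s: "0 < s" and t: "s \<le> t"
  shows "((\<lambda>\<tau>. - of_nat k * V * moment (Suc k) \<tau>) has_integral moment k t - moment k s) {s..t}"
proof -
  \<comment> \<open>the inner radius stays above r0, where the time derivative is controlled\<close>
  define a where "a n = r0 + inverse (real (Suc n))" for n
  define L where "L n = real (Suc n)" for n
  have a: "r0 < a n" "a \<longlonglongrightarrow> r0" for n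
  proof -
    show "r0 < a n" by (simp add: a_def)
    have "(\<lambda>n. r0 + inverse (real (Suc n))) \<longlonglongrightarrow> r0 + 0"
      by (intro tendsto_intros LIMSEQ_inverse_real_of_nat)
    then show "a \<longlonglongrightarrow> r0" by (simp add: a_def[abs_def])
  qed
  have L: "1 \<le> L n" "filterlim L at_top sequentially" for n
    unfolding L_def[abs_def]
    by (simp, rule filterlim_compose[OF filterlim_real_sequentially filterlim_Suc])
  define f where "f n \<tau> = - of_nat k * V * truncated_moment (a n) (L n) (Suc k) (w \<tau>)
     + 2 * pi * (cutoff_error (a n) (L n) k \<tau> - flux k \<tau> (a n))" for n \<tau>
  obtain F where F: "\<And>\<tau> r. \<tau> \<in> {s..t} \<Longrightarrow> r \<in> {r0..r0 + 1} \<Longrightarrow> norm (flux k \<tau> r) \<le> F"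
    using flux_bounded[OF s] by blast
  obtain C where C: "0 \<le> C" "\<And>\<tau>. \<tau> \<in> {0..t} \<Longrightarrow> mass \<tau> \<le> C"
    using mass_bounded by blast
  have ec: "0 \<le> error_const k"
    using r0 by (simp add: error_const_def)
  have err: "2 * pi * norm (cutoff_error (a n) (L n) k \<tau>) \<le> error_const k * C * inverse (L n)" if "\<tau> \<in> {s..t}" for n \<tau>
  proof -
    have "2 * pi * norm (cutoff_error (a n) (L n) k \<tau>) \<le> error_const k * mass \<tau> / L n"
      using that s by (intro cutoff_error_bound a L) auto
    also have "\<dots> \<le> error_const k * C / L n"
      using that s L(1)[of n] by (intro divide_right_mono mult_left_mono C ec) auto
    finally show ?thesis by (simp add: divide_inverse)
  qed
  show ?thesis
  proof (rule has_integral_dominated_convergence)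
    show "(f n has_integral truncated_moment (a n) (L n) k (w t) - truncated_moment (a n) (L n) k (w s)) {s..t}" for n
      unfolding f_def using s L(1)[of n]
      by (intro fundamental_theorem_of_calculus t
          has_vector_derivative_at_within[OF truncated_moment_has_vector_derivative] a) simp_all
    show "(\<lambda>\<tau>. norm (- of_nat k * V) * (C / r0 ^ Suc k) + (error_const k * C * 1 + 2 * pi * F)) integrable_on {s..t}"
      by (rule integrable_const_ivl)
    show "\<forall>\<tau>\<in>{s..t}. norm (f n \<tau>) \<le> norm (- of_nat k * V) * (C / r0 ^ Suc k) + (error_const k * C * 1 + 2 * pi * F)" for n
    proof
      fix \<tau> assume \<tau>: "\<tau> \<in> {s..t}"
      then have \<tau>0: "0 < \<tau>" "0 \<le> \<tau>" using s by auto
      have "continuous_on (annulus (a n) (a n + L n)) (w \<tau>)"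
        by (rule continuous_on_subset[OF w_continuous_space[OF \<tau>0(1)]])
          (use a(1)[of n] in \<open>auto simp: annulus_def exterior_def\<close>)
      then have "norm (truncated_moment (a n) (L n) (Suc k) (w \<tau>)) \<le> mass \<tau> / r0 ^ Suc k"
        unfolding mass_def by (intro truncated_moment_bound r0 a L w_L1 \<tau>0)
      also have "\<dots> \<le> C / r0 ^ Suc k"
        using \<tau> s r0 by (intro divide_right_mono C) auto
      finally have 1: "norm (truncated_moment (a n) (L n) (Suc k) (w \<tau>)) \<le> C / r0 ^ Suc k" .
      have "error_const k * C * inverse (L n) \<le> error_const k * C * 1"
        using L(1)[of n] C(1) ec by (intro mult_left_mono) (auto simp: inverse_le_1_iff)
      then have 2: "2 * pi * norm (cutoff_error (a n) (L n) k \<tau>) \<le> error_const k * C * 1"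
        using err[OF \<tau>, of n] by linarith
      have "a n \<in> {r0..r0 + 1}"
        by (simp add: a_def inverse_le_1_iff)
      then have 3: "2 * pi * norm (flux k \<tau> (a n)) \<le> 2 * pi * F"
        using F \<tau> by (intro mult_left_mono) auto
      have "norm (f n \<tau>) \<le> norm (- of_nat k * V) * norm (truncated_moment (a n) (L n) (Suc k) (w \<tau>))
          + norm (2 * pi * (cutoff_error (a n) (L n) k \<tau> - flux k \<tau> (a n)))"
        unfolding f_def norm_mult[symmetric] by (rule norm_triangle_ineq)
      also have "norm (2 * pi * (cutoff_error (a n) (L n) k \<tau> - flux k \<tau> (a n)))
          = 2 * pi * norm (cutoff_error (a n) (L n) k \<tau> - flux k \<tau> (a n))"
        by (simp add: norm_mult)
      also have "\<dots> \<le> 2 * pi * (norm (cutoff_error (a n) (L n) k \<tau>) + norm (flux k \<tau> (a n)))"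
        by (intro mult_left_mono norm_triangle_ineq4) auto
      also have "\<dots> \<le> error_const k * C * 1 + 2 * pi * F"
        using 2 3 by (simp only: distrib_left)
      finally show "norm (f n \<tau>) \<le> norm (- of_nat k * V) * (C / r0 ^ Suc k) + (error_const k * C * 1 + 2 * pi * F)"
        using mult_left_mono[OF 1, of "norm (- of_nat k * V)"] by fastforce
    qed
    show "\<forall>\<tau>\<in>{s..t}. (\<lambda>n. f n \<tau>) \<longlonglongrightarrow> - of_nat k * V * moment (Suc k) \<tau>"
    proof
      fix \<tau> assume \<tau>: "\<tau> \<in> {s..t}"
      then have \<tau>0: "0 < \<tau>" "0 \<le> \<tau>" using s by auto
      have tm: "(\<lambda>n. truncated_moment (a n) (L n) (Suc k) (w \<tau>)) \<longlonglongrightarrow> moment (Suc k) \<tau>"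
        unfolding moment_def by (intro truncated_moment_tendsto r0 w_continuous_space w_L1 a L \<tau>0)
      have fl: "(\<lambda>n. flux k \<tau> (a n)) \<longlonglongrightarrow> flux k \<tau> r0"
      proof (rule continuous_on_tendsto_compose[OF _ a(2)])
        show "continuous_on {r0..} (flux k \<tau>)"
          by (rule slice_continuous[OF flux_continuous \<tau>0(1)]) simp
        show "\<forall>\<^sub>F n in sequentially. a n \<in> {r0..}"
          by (intro always_eventually allI) (simp add: less_imp_le a(1))
      qed simp
      have iL: "(\<lambda>n. inverse (L n)) \<longlonglongrightarrow> 0"
        by (rule tendsto_inverse_0_at_top[OF L(2)])
      have ce: "(\<lambda>n. cutoff_error (a n) (L n) k \<tau>) \<longlonglongrightarrow> 0"
      proof (rule Lim_null_comparison)
        show "\<forall>\<^sub>F n in sequentially. norm (cutoff_error (a n) (L n) k \<tau>) \<le> error_const k * C / (2 * pi) * inverse (L n)"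
        proof (intro always_eventually allI)
          fix n
          have "norm (cutoff_error (a n) (L n) k \<tau>) \<le> (error_const k * C * inverse (L n)) / (2 * pi)"
            by (subst pos_le_divide_eq) (use err[OF \<tau>, of n] in \<open>simp_all only: mult_ac\<close>, simp)
          then show "norm (cutoff_error (a n) (L n) k \<tau>) \<le> error_const k * C / (2 * pi) * inverse (L n)"
            by simp
        qed
        show "(\<lambda>n. error_const k * C / (2 * pi) * inverse (L n)) \<longlonglongrightarrow> 0"
          by (rule tendsto_mult_right_zero[OF iL])
      qed
      have "(\<lambda>n. f n \<tau>) \<longlonglongrightarrow> - of_nat k * V * moment (Suc k) \<tau> + 2 * pi * (0 - flux k \<tau> r0)"
        unfolding f_def by (intro tendsto_intros tm fl ce)
      then show "(\<lambda>n. f n \<tau>) \<longlonglongrightarrow> - of_nat k * V * moment (Suc k) \<tau>"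
        by (simp add: flux_boundary[OF \<tau>0(1)])
    qed
    show "(\<lambda>n. truncated_moment (a n) (L n) k (w t) - truncated_moment (a n) (L n) k (w s)) \<longlonglongrightarrow> moment k t - moment k s"
      unfolding moment_def using s t
      by (intro tendsto_diff truncated_moment_tendsto r0 w_continuous_space w_L1 a L) auto
  qed
qed

lemma moment_has_vector_derivative:
  assumes t: "0 < t"
  shows "(moment k has_vector_derivative - of_nat k * V * moment (Suc k) t) (at t)"
proof -
  let ?g = "\<lambda>\<tau>. - of_nat k * V * moment (Suc k) \<tau>"
  have "continuous_on {t/2..2*t} ?g"
    using t by (intro continuous_intros continuous_on_subset[OF moment_continuous]) auto
  from integral_has_vector_derivative[OF this, of t]
  have "((\<lambda>x. integral {t/2..x} ?g) has_vector_derivative ?g t) (at t within {t/2..2*t})"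
    using t by simp
  then have "((\<lambda>x. integral {t/2..x} ?g) has_vector_derivative ?g t) (at t)"
    using t by (simp add: at_within_Icc_at)
  then have "((\<lambda>x. moment k (t/2) + integral {t/2..x} ?g) has_vector_derivative 0 + ?g t) (at t)"
    by (rule has_vector_derivative_add[OF has_vector_derivative_const])
  then have "((\<lambda>x. moment k (t/2) + integral {t/2..x} ?g) has_vector_derivative ?g t) (at t)"
    by simp
  then show ?thesis
  proof (rule has_vector_derivative_transform_within_open)
    show "open {t/2<..}" by simp
    fix x assume "x \<in> {t/2<..}"
    then show "moment k (t/2) + integral {t/2..x} ?g = moment k x"
      using integral_unique[OF moment_increment[of "t/2" x k]] t by simp
  qed (use t in simp)
qed

lemma moment_set_integral:
  assumes "0 \<le> t"
  shows "(LINT z:exterior r0|lebesgue. of_real (w t z) / z ^ k) = moment k t"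
  unfolding moment_def by (intro set_lebesgue_integral_eq_integral exterior_moment_integrable r0 w_L1 assms)

text \<open>
  A bound with a constant for all $k$ at once is what the uniqueness result asks for; the maximum of
  the $L_1$ norm over the time interval provides it.
\<close>

lemma moment_constant:
  assumes "\<And>k. 2 \<le> k \<Longrightarrow> moment k 0 = 0" "0 \<le> t"
  shows "moment k t = moment k 0"
proof (rule hierarchy_unique[OF r0 moment_continuous moment_has_vector_derivative _ assms])
  fix T
  obtain C where C: "\<And>t. t \<in> {0..T} \<Longrightarrow> mass t \<le> C"
    using mass_bounded by blast
  have "norm (moment k t) \<le> C / r0 ^ k" if "t \<in> {0..T}" for k t
    using moment_bound[of t k] divide_right_mono[OF C[OF that], of "r0 ^ k"] that r0 by fastforce
  then show "\<exists>C. \<forall>k. \<forall>t\<in>{0..T}. norm (moment k t) \<le> C / r0 ^ k"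
    by blast
qed

end

theorem lemma2p4:
  fixes r0 vx vy :: real
    and w0 :: "int \<Rightarrow> real \<Rightarrow> complex"
    and w :: "real \<Rightarrow> complex \<Rightarrow> real"
  assumes "r0 > 0"
    and "oseen_flow r0 vx vy w0 w"
    and "w 0 \<in> M r0 vx vy"
  shows "\<forall>t>0. w t \<in> M r0 vx vy"
proof (intro allI impI)
  fix t :: real
  assume t: "0 < t"
  interpret oseen_solution r0 vx vy w0 w
    using assms(1,2) by unfold_locales
  have init: "moment k 0 = 4 * pi * \<i> * of_nat k * v_rad vx vy (int k)" for k
    using assms(3) moment_set_integral[of 0 k] by (simp add: M_def)
  have "moment k 0 = 0" if "2 \<le> k" for k
    using that by (simp add: init v_rad_def)
  then have "moment k t = moment k 0" for k
    using t by (intro moment_constant) auto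
  then show "w t \<in> M r0 vx vy"
    using t w_L1[of t] moment_set_integral[of t] by (simp add: M_def init)
qed

end
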